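(* Let $1<p<\infty$, let $n \geq 1$, and let $Q_0 \subset \mathbb{R}^n$ be a bounded cube. Then there exist a function $g \in JN_p(Q_0) \setminus VJN_p(Q_0)$ and a function $g_0 \in VJN_p(Q_0) \setminus L^p(Q_0)$.
   Context: All cubes in $\mathbb{R}^n$ have edges parallel to the coordinate axes; $l(Q)$ denotes the side length of a cube $Q$. For an integrable function $h$ on a cube $Q$ write $h_Q := \frac{1}{|Q|}\int_Q h$. For a bounded cube $Q_0 \subset \mathbb{R}^n$ and $1<p<\infty$, a function $h$ belongs to $JN_p(Q_0)$ if $h \in L^1(Q_0)$ and there is a constant $K<\infty$ such that $\sum_{i=1}^\infty |Q_i| \left( \frac{1}{|Q_i|}\int_{Q_i} |h - h_{Q_i}| \right)^p \leq K^p$ for all countable collections of pairwise disjoint cubes $(Q_i)_{i=1}^\infty$ contained in $Q_0$. A function $h$ belongs to $VJN_p(Q_0)$ if $h \in JN_p(Q_0)$ and $\lim_{a\to 0} \sup \sum_{i=1}^\infty |Q_i| \left( \frac{1}{|Q_i|}\int_{Q_i} |h - h_{Q_i}| \right)^p = 0$, where for each $a>0$ the supremum is over all collections of pairwise disjoint cubes $Q_i \subset Q_0$ with $l(Q_i) \leq a$. *)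

theory Defs
  imports "HOL-Analysis.Analysis"
begin

text \<open>A cube is a product of bounded nondegenerate intervals of equal length. Each factor may
  contain or omit either of its endpoints, so that open, closed and half-open cubes are all
  covered, and ``pairwise disjoint'' can be taken literally (e.g. for dyadic partitions).\<close>

definition cube_of_side :: "real \<Rightarrow> (real ^ 'n) set \<Rightarrow> bool" where
  "cube_of_side l Q \<longleftrightarrow> 0 < l \<and>
     (\<exists>(a :: real ^ 'n) I. (\<forall>i. {a $ i <..< a $ i + l} \<subseteq> I i \<and> I i \<subseteq> {a $ i .. a $ i + l})
        \<and> Q = {x. \<forall>i. x $ i \<in> I i})"

definition is_cube :: "(real ^ 'n) set \<Rightarrow> bool" where
  "is_cube Q \<longleftrightarrow> (\<exists>l. cube_of_side l Q)"

definition average :: "(real ^ 'n) set \<Rightarrow> (real ^ 'n \<Rightarrow> real) \<Rightarrow> real" where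
  "average Q h = (1 / measure lebesgue Q) * (LINT x:Q|lebesgue. h x)"

definition mean_oscillation :: "(real ^ 'n) set \<Rightarrow> (real ^ 'n \<Rightarrow> real) \<Rightarrow> real" where
  "mean_oscillation Q h = average Q (\<lambda>x. \<bar>h x - average Q h\<bar>)"

text \<open>The sums are taken in the extended nonnegative reals, hence always exist.\<close>

definition JN_sum :: "real \<Rightarrow> (real ^ 'n \<Rightarrow> real) \<Rightarrow> (real ^ 'n) set set \<Rightarrow> ennreal" where
  "JN_sum p h C = (\<Sum>\<^sub>\<infinity>Q\<in>C. ennreal (measure lebesgue Q * mean_oscillation Q h powr p))"

definition disjoint_cubes :: "(real ^ 'n) set \<Rightarrow> (real ^ 'n) set set set" where
  "disjoint_cubes Q0 =
     {C. countable C \<and> pairwise disjnt C \<and> (\<forall>Q\<in>C. is_cube Q \<and> Q \<subseteq> Q0)}"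

text \<open>The function spaces consist of functions rather than of classes modulo null sets;
  membership depends only on the values almost everywhere in \<open>Q0\<close>.\<close>

definition JN :: "real \<Rightarrow> (real ^ 'n) set \<Rightarrow> (real ^ 'n \<Rightarrow> real) set" where
  "JN p Q0 = {h. set_integrable lebesgue Q0 h \<and>
     (\<exists>K\<ge>0. \<forall>C\<in>disjoint_cubes Q0. JN_sum p h C \<le> ennreal (K powr p))}"

definition VJN :: "real \<Rightarrow> (real ^ 'n) set \<Rightarrow> (real ^ 'n \<Rightarrow> real) set" where
  "VJN p Q0 = {h \<in> JN p Q0.
     ((\<lambda>a. SUP C \<in> {C \<in> disjoint_cubes Q0. \<forall>Q\<in>C. \<exists>l\<le>a. cube_of_side l Q}. JN_sum p h C)
        \<longlongrightarrow> 0) (at_right (0 :: real))}"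

definition Lp :: "real \<Rightarrow> (real ^ 'n) set \<Rightarrow> (real ^ 'n \<Rightarrow> real) set" where
  "Lp p Q0 = {h. set_borel_measurable lebesgue Q0 h \<and>
     set_integrable lebesgue Q0 (\<lambda>x. \<bar>h x\<bar> powr p)}"

end

theory Submission
  imports Defs
begin

text \<open>
  Both functions depend on one coordinate of \<open>Q0\<close> only, rescaled to run through \<open>[0, 1]\<close>, and
  share one construction. Fix rapidly growing binary places \<open>digit_pos 1 < digit_pos 2 < ...\<close> and let
  \<open>level k\<close> consist of the points whose first \<open>k\<close> selected digits vanish; these sets decrease,
  \<open>level k\<close> has density \<open>2^-k\<close> and is spread out very evenly over the intervals that make up
  \<open>level (k - 1)\<close>. The step function \<open>\<phi>\<close> takes the value \<open>H k\<close> on \<open>level k - level (k + 1)\<close>, where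
  \<open>H (k + 1) \<le> 2^(1/p) * H k\<close>. The quantity \<open>W k = H k^p / 2^k\<close> is, up to a factor \<open>2\<close>, the contribution of
  the step \<open>k\<close> to the \<open>p\<close>-th power of the \<open>L^p\<close> norm.

  The point is that the steps do not add up in a John--Nirenberg sum. For a cube whose side lies between two
  consecutive digit scales, \<open>oscillation_le_weight\<close> bounds its term by a constant times \<open>W k\<close> times
  the mass that the cube receives from one measure, which is independent of the cube. Its main part is the
  normalised restriction of Lebesgue measure to a very deep level, which has total mass \<open>1\<close>: it is the measure
  that a typical cube meeting \<open>level k\<close> sees as \<open>2^k\<close> times the length of its part in \<open>level k\<close>.
  The exceptions are cubes near the end points of the intervals of some earlier level, and they are paid for by
  thin neighbourhoods \<open>fence j\<close> of these end points; because the digits are sparse, the fences have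
  summable weights. Disjoint cubes therefore have terms that sum to at most a constant times
  \<open>sup W k\<close>, taken over the \<open>k\<close> that their sizes allow (\<open>JN_sum_le\<close>).

  Hence \<open>\<phi>\<close> always gives a function in \<open>JN\<close>; it is in \<open>VJN\<close> if \<open>W k \<longlonglongrightarrow> 0\<close>, and it is not in
  \<open>Lp\<close> if the \<open>W k\<close> have infinite sum. The choice \<open>W k = 1 / (k + 1)\<close> gives \<open>g0\<close>. With \<open>W k = 1\<close> the
  grid cubes at the scale of the next digit that lie over \<open>level k\<close> each see a jump of size comparable to
  \<open>H k\<close> and have total volume \<open>2^-k\<close> times that of \<open>Q0\<close>, so that their terms have a sum bounded below
  uniformly in \<open>k\<close> (\<open>JN_sum_grid_ge\<close>). This gives \<open>g\<close>.
\<close>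

section \<open>Sets of binary digits\<close>

text \<open>The sets that are unions of dyadic intervals of length \<open>2^-r\<close>. The implication loops as a rewrite rule,
  hence the explicit introduction and destruction rules below.\<close>

definition dyadic_inv :: "nat \<Rightarrow> real set \<Rightarrow> bool" where
  "dyadic_inv r X \<longleftrightarrow> (\<forall>s t. \<lfloor>2 ^ r * s\<rfloor> = \<lfloor>2 ^ r * t\<rfloor> \<longrightarrow> (s \<in> X \<longleftrightarrow> t \<in> X))"

lemma floor_coarsen: "\<lfloor>2 ^ r * t\<rfloor> = \<lfloor>2 ^ (r + q) * t\<rfloor> div 2 ^ q" for t :: real
proof -
  have "\<lfloor>(2 ^ (r + q) * t) / real_of_int (2 ^ q)\<rfloor> = \<lfloor>2 ^ (r + q) * t\<rfloor> div 2 ^ q"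
    using floor_divide_real_eq_div[of "2 ^ q" "2 ^ (r + q) * t"] by simp
  moreover have "(2 ^ (r + q) * t) / real_of_int (2 ^ q) = 2 ^ r * t"
    by (simp add: power_add)
  ultimately show ?thesis by simp
qed

lemma floor_eq_coarsen:
  fixes s t :: real
  assumes "\<lfloor>2 ^ q * s\<rfloor> = \<lfloor>2 ^ q * t\<rfloor>" and "r \<le> q"
  shows "\<lfloor>2 ^ r * s\<rfloor> = \<lfloor>2 ^ r * t\<rfloor>"
proof -
  have "q = r + (q - r)" using assms(2) by simp
  then show ?thesis
    using assms(1) floor_coarsen[of r s "q - r"] floor_coarsen[of r t "q - r"] by presburger
qed

lemma dyadic_invI:
  "(\<And>s t. \<lfloor>2 ^ r * s\<rfloor> = \<lfloor>2 ^ r * t\<rfloor> \<Longrightarrow> s \<in> X \<longleftrightarrow> t \<in> X) \<Longrightarrow> dyadic_inv r X"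
  unfolding dyadic_inv_def by (intro allI impI)

lemma dyadic_invD:
  "dyadic_inv r X \<Longrightarrow> \<lfloor>2 ^ r * s\<rfloor> = \<lfloor>2 ^ r * t\<rfloor> \<Longrightarrow> s \<in> X \<longleftrightarrow> t \<in> X"
  unfolding dyadic_inv_def by (elim allE impE)

lemma dyadic_inv_mono:
  assumes "dyadic_inv r X" and "r \<le> q"
  shows "dyadic_inv q X"
  by (rule dyadic_invI, rule dyadic_invD[OF assms(1)], erule floor_eq_coarsen) (rule assms(2))

lemma dyadic_inv_Int:
  assumes "dyadic_inv r X" and "dyadic_inv r Y"
  shows "dyadic_inv r (X \<inter> Y)"
proof (rule dyadic_invI)
  fix s t :: real
  assume "\<lfloor>2 ^ r * s\<rfloor> = \<lfloor>2 ^ r * t\<rfloor>"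
  from dyadic_invD[OF assms(1) this] dyadic_invD[OF assms(2) this]
  show "s \<in> X \<inter> Y \<longleftrightarrow> t \<in> X \<inter> Y" by simp
qed

lemma measure_lborel_shift:
  fixes X :: "real set"
  assumes "X \<in> sets borel"
  shows "measure lborel ((+) e ` X) = measure lborel X"
proof -
  have "t \<in> (+) e ` X" if "t - e \<in> X" for t
    using imageI[OF that, of "(+) e"] by simp
  then have "(+) e ` X = (\<lambda>t. t - e) -` X \<inter> space lborel" by auto
  also have "\<dots> \<in> sets lborel"
    using assms by (intro measurable_sets[of _ _ borel]) auto
  finally have 1: "(+) e ` X \<in> sets borel" by simp
  show ?thesis
    using measure_translation[of e X] assms 1 by (simp add: measure_completion)
qed

text \<open>Translation by \<open>2^-(r+1)\<close> exchanges the points of \<open>X\<close> with even and with odd last digit, and stays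
  inside the dyadic intervals of which \<open>X\<close> consists.\<close>

lemma measure_even_digit:
  assumes "dyadic_inv r X" and [measurable]: "X \<in> sets borel" and fin: "emeasure lborel X < \<infinity>"
  shows "measure lborel (X \<inter> {t. even \<lfloor>2 ^ Suc r * t\<rfloor>}) = measure lborel X / 2"
proof -
  let ?e = "1 / 2 ^ Suc r :: real"
  let ?A = "X \<inter> {t. even \<lfloor>2 ^ Suc r * t\<rfloor>}" and ?B = "X \<inter> {t. odd \<lfloor>2 ^ Suc r * t\<rfloor>}"
  have fl: "\<lfloor>2 ^ Suc r * (?e + t)\<rfloor> = \<lfloor>2 ^ Suc r * t\<rfloor> + 1" for t
    by (simp add: distrib_left del: power_Suc)
  have fl2: "\<lfloor>2 ^ r * t\<rfloor> = \<lfloor>2 ^ Suc r * t\<rfloor> div 2" for t :: real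
    using floor_coarsen[of r t 1] by simp
  have inX: "?e + t \<in> X \<longleftrightarrow> t \<in> X" if "even \<lfloor>2 ^ Suc r * t\<rfloor>" for t
  proof -
    have "\<lfloor>2 ^ r * (?e + t)\<rfloor> = \<lfloor>2 ^ r * t\<rfloor>"
      unfolding fl2 fl using that by presburger
    then show ?thesis by (rule dyadic_invD[OF assms(1)])
  qed
  have "(+) ?e ` ?A = ?B"
  proof (intro equalityI subsetI)
    fix s assume "s \<in> (+) ?e ` ?A"
    then obtain t where t: "s = ?e + t" "t \<in> X" "even \<lfloor>2 ^ Suc r * t\<rfloor>" by blast
    have "s \<in> X" using inX[OF t(3)] t by simp
    moreover have "odd \<lfloor>2 ^ Suc r * s\<rfloor>" unfolding t(1) fl using t(3) by simp
    ultimately show "s \<in> ?B" by blast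
  next
    fix s assume s: "s \<in> ?B"
    define t where "t = s - ?e"
    have st: "s = ?e + t" by (simp add: t_def)
    have ev: "even \<lfloor>2 ^ Suc r * t\<rfloor>" using s unfolding st using fl[of t] by auto
    have "t \<in> X" using inX[OF ev] s st by simp
    then show "s \<in> (+) ?e ` ?A" using ev st by blast
  qed
  moreover have "?A \<in> sets borel" by measurable
  ultimately have "measure lborel ?B = measure lborel ?A"
    using measure_lborel_shift[of ?A ?e] by metis
  moreover have "measure lborel (?A \<union> ?B) = measure lborel ?A + measure lborel ?B"
  proof (rule measure_Union)
    have "emeasure lborel ?A \<le> emeasure lborel X" "emeasure lborel ?B \<le> emeasure lborel X"
      by (intro emeasure_mono; auto)+
    then show "emeasure lborel ?A \<noteq> \<infinity>" "emeasure lborel ?B \<noteq> \<infinity>"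
      using fin by (auto simp del: power_Suc intro: neq_top_trans)
    show "?A \<inter> ?B = {}" by blast
  qed measurable
  moreover have "?A \<union> ?B = X" by blast
  ultimately have "measure lborel X = measure lborel ?A + measure lborel ?A" by metis
  then show ?thesis by linarith
qed

text \<open>The gaps grow linearly so that \<open>2^k * 2^digit_pos k / 2^digit_pos (k + 1)\<close> is summable; this makes
  the weights of the fences summable.\<close>

definition digit_pos :: "nat \<Rightarrow> nat" where "digit_pos k = k * (k + 1)"

definition level :: "nat \<Rightarrow> real set" where
  "level k = {t. \<forall>j\<in>{1..k}. even \<lfloor>2 ^ digit_pos j * t\<rfloor>}"

lemma digit_pos_0 [simp]: "digit_pos 0 = 0" by (simp add: digit_pos_def)

lemma digit_pos_Suc: "digit_pos (Suc k) = digit_pos k + 2 * Suc k" by (simp add: digit_pos_def)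

lemma digit_pos_mono: "i \<le> k \<Longrightarrow> digit_pos i \<le> digit_pos k"
  unfolding digit_pos_def by (intro mult_le_mono) auto

lemma digit_pos_less: "digit_pos k \<le> digit_pos (Suc k) - 1" by (simp add: digit_pos_Suc)

lemma level_0 [simp]: "level 0 = UNIV" by (simp add: level_def)

lemma level_Suc: "level (Suc k) = level k \<inter> {t. even \<lfloor>2 ^ digit_pos (Suc k) * t\<rfloor>}"
  unfolding level_def by (auto simp: atLeastAtMostSuc_conv)

lemma level_antimono: "i \<le> k \<Longrightarrow> level k \<subseteq> level i"
  unfolding level_def by auto

lemma level_borel [measurable]: "level k \<in> sets borel"
proof (induction k)
  case (Suc k)
  note [measurable] = Suc
  show ?case unfolding level_Suc by measurable
qed simp

lemma dyadic_inv_level: "dyadic_inv (digit_pos k) (level k)"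
proof (rule dyadic_invI)
  fix s t :: real
  assume "\<lfloor>2 ^ digit_pos k * s\<rfloor> = \<lfloor>2 ^ digit_pos k * t\<rfloor>"
  then have "\<lfloor>2 ^ digit_pos j * s\<rfloor> = \<lfloor>2 ^ digit_pos j * t\<rfloor>" if "j \<in> {1..k}" for j
    by (rule floor_eq_coarsen) (use that in \<open>simp add: digit_pos_mono\<close>)
  then show "s \<in> level k \<longleftrightarrow> t \<in> level k" by (simp add: level_def)
qed

text \<open>The scale \<open>digit_pos (Suc k) - 1\<close> is the coarsest on which the digit \<open>digit_pos (Suc k)\<close> is
  evenly distributed; every further selected digit halves the set again.\<close>

lemma measure_Int_level:
  assumes X: "dyadic_inv (digit_pos (Suc k) - 1) X" "X \<in> sets borel" "emeasure lborel X < \<infinity>" "X \<subseteq> level k"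
    and "k \<le> i"
  shows "measure lborel (X \<inter> level i) = measure lborel X / 2 ^ (i - k)"
  using \<open>k \<le> i\<close>
proof (induction rule: dec_induct)
  case base
  then show ?case using X by (simp add: Int_absorb2)
next
  case (step i)
  have "dyadic_inv (digit_pos (Suc i) - 1) (X \<inter> level i)"
  proof (rule dyadic_inv_Int)
    show "dyadic_inv (digit_pos (Suc i) - 1) X"
      using X(1) by (rule dyadic_inv_mono) (use step digit_pos_mono[of "Suc k" "Suc i"] in auto)
    show "dyadic_inv (digit_pos (Suc i) - 1) (level i)"
      using dyadic_inv_level digit_pos_less by (rule dyadic_inv_mono)
  qed
  moreover have "emeasure lborel (X \<inter> level i) < \<infinity>"
    using X(2,3) emeasure_mono[of "X \<inter> level i" X lborel] by (auto simp: order.strict_trans1)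
  ultimately have "measure lborel ((X \<inter> level i) \<inter> {t. even \<lfloor>2 ^ Suc (digit_pos (Suc i) - 1) * t\<rfloor>})
      = measure lborel (X \<inter> level i) / 2"
    using X(2) by (intro measure_even_digit) auto
  moreover have "Suc (digit_pos (Suc i) - 1) = digit_pos (Suc i)" by (simp add: digit_pos_Suc)
  ultimately show ?case
    using step by (simp add: level_Suc Int_assoc Suc_diff_le)
qed

section \<open>The step function\<close>

definition shell :: "nat \<Rightarrow> real set" where
  "shell k = level k - level (Suc k)"

lemma shell_borel [measurable]: "shell k \<in> sets borel"
  unfolding shell_def by measurable

lemma shell_disjoint:
  assumes "t \<in> shell j" "t \<in> shell k"
  shows "j = k"
proof (rule ccontr)
  assume "j \<noteq> k"
  then consider "Suc j \<le> k" | "Suc k \<le> j" by linarith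
  then show False
    using assms level_antimono[of "Suc j" k] level_antimono[of "Suc k" j] unfolding shell_def by cases auto
qed

lemma shell_cases:
  assumes "t \<notin> level k"
  obtains j where "j < k" "t \<in> shell j"
  using assms
proof (induction k arbitrary: thesis)
  case (Suc k)
  show ?case
  proof (cases "t \<in> level k")
    case True
    then show ?thesis using Suc.prems by (intro Suc.prems(1)[of k]) (auto simp: shell_def)
  next
    case False
    show ?thesis
      using Suc.IH[of thesis, OF _ False] Suc.prems(1) less_SucI by blast
  qed
qed simp

lemma emeasure_Int_finite:
  fixes X :: "real set"
  assumes "X \<in> sets borel" "emeasure lborel X < \<infinity>"
  shows "emeasure lborel (X \<inter> Y) \<noteq> top"
proof (rule neq_top_trans)
  show "emeasure lborel (X \<inter> Y) \<le> emeasure lborel X"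
    using assms(1) by (intro emeasure_mono) auto
qed (use assms(2) in auto)

lemma measure_Int_shell:
  assumes X: "dyadic_inv (digit_pos (Suc k) - 1) X" "X \<in> sets borel" "emeasure lborel X < \<infinity>" "X \<subseteq> level k"
    and "k \<le> i"
  shows "measure lborel (X \<inter> shell i) = measure lborel X / 2 ^ Suc (i - k)"
proof -
  have fin: "emeasure lborel (X \<inter> level i) \<noteq> top" for i
    using X(2,3) by (rule emeasure_Int_finite)
  have "X \<inter> shell i = X \<inter> level i - X \<inter> level (Suc i)" by (auto simp: shell_def)
  moreover have "measure lborel (X \<inter> level i - X \<inter> level (Suc i))
      = measure lborel (X \<inter> level i) - measure lborel (X \<inter> level (Suc i))"
    using fin X(2) level_antimono[of i "Suc i"] by (intro measure_Diff) auto
  ultimately have "measure lborel (X \<inter> shell i) = measure lborel (X \<inter> level i) - measure lborel (X \<inter> level (Suc i))"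
    by metis
  then show ?thesis
    using measure_Int_level[OF X, of i] measure_Int_level[OF X, of "Suc i"] \<open>k \<le> i\<close>
    by (simp add: Suc_diff_le)
qed

text \<open>The growth condition makes \<open>W k\<close> decreasing and, since \<open>p > 1\<close>, keeps the mass of \<open>\<phi>\<close> over
  \<open>level k\<close> comparable to that of the constant \<open>H k\<close>: halving the set beats the increase by \<open>2^(1/p)\<close>.\<close>

locale staircase =
  fixes p :: real and H :: "nat \<Rightarrow> real"
  assumes p_gt_1: "1 < p" and H_pos: "0 < H k" and H_Suc_mono: "H k \<le> H (Suc k)"
    and H_growth: "H (Suc k) \<le> 2 powr (1 / p) * H k"
begin

text \<open>The value on the null set that belongs to all levels is \<open>0\<close>.\<close>

definition \<phi> :: "real \<Rightarrow> real" where
  "\<phi> t = (\<Sum>k. H k * indicator (shell k) t)"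

lemma phi_borel [measurable]: "\<phi> \<in> borel_measurable borel"
  unfolding \<phi>_def by measurable

lemma indicator_shell: "t \<in> shell k \<Longrightarrow> n \<notin> {k} \<Longrightarrow> indicator (shell n) t = 0"
  using shell_disjoint by (metis indicator_simps(2) singletonI)

lemma phi_shell:
  assumes "t \<in> shell k"
  shows "\<phi> t = H k"
  unfolding \<phi>_def using assms by (subst suminf_finite[of "{k}"]) (simp_all add: indicator_shell)

lemma phi_core: "(\<And>k. t \<in> level k) \<Longrightarrow> \<phi> t = 0"
  unfolding \<phi>_def by (simp add: shell_def)

lemma ennreal_phi: "ennreal (\<phi> t) = (\<Sum>k. ennreal (H k) * indicator (shell k) t)"
proof (cases "\<exists>k. t \<in> shell k")
  case True
  then obtain k where k: "t \<in> shell k" by blast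
  show ?thesis
    using k by (subst suminf_finite[of "{k}"]) (simp_all add: indicator_shell phi_shell)
next
  case False
  then have "t \<in> level k" for k using shell_cases[of t k] by blast
  then show ?thesis using False by (simp add: phi_core)
qed

lemma phi_nonneg: "0 \<le> \<phi> t"
proof (cases "\<exists>k. t \<in> shell k")
  case True
  then show ?thesis using phi_shell H_pos by (metis less_imp_le)
next
  case False
  then have "t \<in> level k" for k using shell_cases[of t k] by blast
  then show ?thesis by (simp add: phi_core)
qed

lemma H_mono: "i \<le> k \<Longrightarrow> H i \<le> H k"
  using H_Suc_mono by (rule lift_Suc_mono_le)

definition \<rho> :: real where "\<rho> = 2 powr (1 / p) / 2"

lemma rho: "0 < \<rho>" "\<rho> < 1"
proof -
  have "2 powr (1 / p) < 2 powr (1 :: real)"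
    using p_gt_1 by (intro powr_less_mono) auto
  then show "0 < \<rho>" "\<rho> < 1" by (auto simp: \<rho>_def)
qed

lemma H_le: "H (k + i) \<le> (2 * \<rho>) ^ i * H k"
proof (induction i)
  case (Suc i)
  have "H (k + Suc i) \<le> (2 * \<rho>) * H (k + i)"
    using H_growth[of "k + i"] by (simp add: \<rho>_def)
  also have "\<dots> \<le> (2 * \<rho>) * ((2 * \<rho>) ^ i * H k)"
    using Suc rho by (intro mult_left_mono) auto
  finally show ?case by simp
qed simp

definition C0 :: real where "C0 = 1 / (2 * (1 - \<rho>))"

lemma C0_pos: "0 < C0"
  using rho by (simp add: C0_def)

lemma nn_integral_phi_eq:
  assumes [measurable]: "X \<in> sets borel"
  shows "(\<integral>\<^sup>+t. ennreal (\<phi> t) * indicator X t \<partial>lborel) = (\<Sum>i. ennreal (H i) * emeasure lborel (X \<inter> shell i))"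
proof -
  have "(\<integral>\<^sup>+t. ennreal (\<phi> t) * indicator X t \<partial>lborel)
      = (\<integral>\<^sup>+t. (\<Sum>i. ennreal (H i) * indicator (X \<inter> shell i) t) \<partial>lborel)"
    unfolding ennreal_phi ennreal_suminf_multc[symmetric] by (auto intro!: nn_integral_cong suminf_cong split: split_indicator)
  also have "\<dots> = (\<Sum>i. \<integral>\<^sup>+t. ennreal (H i) * indicator (X \<inter> shell i) t \<partial>lborel)"
    by (intro nn_integral_suminf) measurable
  also have "\<dots> = (\<Sum>i. ennreal (H i) * emeasure lborel (X \<inter> shell i))"
    by (intro suminf_cong nn_integral_cmult_indicator) simp
  finally show ?thesis .
qed

text \<open>The shells contribute a geometric series of ratio \<open>\<rho> < 1\<close>.\<close>

lemma nn_integral_phi_le: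
  assumes X: "dyadic_inv (digit_pos (Suc k) - 1) X" "X \<in> sets borel" "emeasure lborel X < \<infinity>" "X \<subseteq> level k"
  shows "(\<integral>\<^sup>+t. ennreal (\<phi> t) * indicator X t \<partial>lborel) \<le> ennreal (C0 * H k * measure lborel X)"
proof -
  let ?a = "H k * measure lborel X / 2"
  define g where "g i = (if i < k then 0 else ?a * \<rho> ^ (i - k))" for i
  have "(\<lambda>i. ?a * \<rho> ^ i) sums (?a * (1 / (1 - \<rho>)))"
    using rho by (intro sums_mult geometric_sums) simp
  then have "(\<lambda>i. g (i + k)) sums (?a * (1 / (1 - \<rho>)))"
    by (simp add: g_def)
  then have g: "g sums (C0 * H k * measure lborel X)"
    by (subst (asm) sums_zero_iff_shift) (auto simp: g_def C0_def field_simps)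
  have g0: "0 \<le> g i" for i
    using H_pos[of k] rho by (simp add: g_def)
  have "ennreal (H i) * emeasure lborel (X \<inter> shell i) \<le> ennreal (g i)" for i
  proof (cases "i < k")
    case True
    then have "X \<inter> shell i = {}"
      using X(4) level_antimono[of "Suc i" k] by (auto simp: shell_def)
    then show ?thesis by simp
  next
    case False
    have "emeasure lborel (X \<inter> shell i) = ennreal (measure lborel (X \<inter> shell i))"
      using emeasure_Int_finite[OF X(2,3)] by (intro emeasure_eq_ennreal_measure) auto
    also have "\<dots> = ennreal (measure lborel X / 2 ^ Suc (i - k))"
      using measure_Int_shell[OF X, of i] False by simp
    finally have "ennreal (H i) * emeasure lborel (X \<inter> shell i) = ennreal (H i * (measure lborel X / 2 ^ Suc (i - k)))"
      using H_pos[of i] by (simp add: ennreal_mult[symmetric] less_imp_le)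
    also have "\<dots> \<le> ennreal (((2 * \<rho>) ^ (i - k) * H k) * (measure lborel X / 2 ^ Suc (i - k)))"
      using H_le[of k "i - k"] False by (intro ennreal_leI mult_right_mono) auto
    also have "((2 * \<rho>) ^ (i - k) * H k) * (measure lborel X / 2 ^ Suc (i - k)) = g i"
      using False by (simp add: g_def power_mult_distrib)
    finally show ?thesis .
  qed
  then have "(\<integral>\<^sup>+t. ennreal (\<phi> t) * indicator X t \<partial>lborel) \<le> (\<Sum>i. ennreal (g i))"
    unfolding nn_integral_phi_eq[OF X(2)] by (intro suminf_le) auto
  also have "\<dots> = ennreal (C0 * H k * measure lborel X)"
    using g0 g by (rule suminf_ennreal_eq)
  finally show ?thesis .
qed

end

section \<open>The dominating measure\<close>

lemma dyadic_inv_interval: "dyadic_inv r {of_int x / 2 ^ r ..< of_int y / 2 ^ r}"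
proof (rule dyadic_invI)
  fix s t :: real
  assume eq: "\<lfloor>2 ^ r * s\<rfloor> = \<lfloor>2 ^ r * t\<rfloor>"
  have *: "u \<in> {of_int x / 2 ^ r ..< of_int y / 2 ^ r} \<longleftrightarrow> x \<le> \<lfloor>2 ^ r * u\<rfloor> \<and> \<lfloor>2 ^ r * u\<rfloor> < y" for u :: real
    by (simp add: le_floor_iff floor_less_iff field_simps)
  show "s \<in> {of_int x / 2 ^ r ..< of_int y / 2 ^ r} \<longleftrightarrow> t \<in> {of_int x / 2 ^ r ..< of_int y / 2 ^ r}"
    unfolding * eq ..
qed

lemma outer_hull:
  fixes b c :: real
  obtains X where "dyadic_inv r X" "X \<in> sets borel" "emeasure lborel X < \<infinity>"
    "{b..c} \<subseteq> X" "X \<subseteq> {b - 1 / 2 ^ r .. c + 1 / 2 ^ r}"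
proof
  let ?X = "{of_int \<lfloor>2 ^ r * b\<rfloor> / 2 ^ r ..< of_int (\<lfloor>2 ^ r * c\<rfloor> + 1) / 2 ^ r :: real}"
  show "dyadic_inv r ?X" by (rule dyadic_inv_interval)
  have b: "of_int \<lfloor>2 ^ r * b\<rfloor> \<le> 2 ^ r * b" "2 ^ r * b - 1 < of_int \<lfloor>2 ^ r * b\<rfloor>"
    by linarith+
  have c: "of_int \<lfloor>2 ^ r * c\<rfloor> \<le> 2 ^ r * c" "2 ^ r * c < of_int (\<lfloor>2 ^ r * c\<rfloor> + 1)"
    by linarith+
  have "of_int \<lfloor>2 ^ r * b\<rfloor> / 2 ^ r \<le> b" "c < of_int (\<lfloor>2 ^ r * c\<rfloor> + 1) / 2 ^ r"
    using b c by (simp_all add: field_simps)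
  then show "{b..c} \<subseteq> ?X" by auto
  have "(2 ^ r * b - 1) / 2 ^ r \<le> of_int \<lfloor>2 ^ r * b\<rfloor> / 2 ^ r"
      "of_int (\<lfloor>2 ^ r * c\<rfloor> + 1) / 2 ^ r \<le> (2 ^ r * c + 1) / 2 ^ r"
    using b c by (intro divide_right_mono; simp)+
  then show "?X \<subseteq> {b - 1 / 2 ^ r .. c + 1 / 2 ^ r}"
    by (auto simp: add_divide_distrib diff_divide_distrib)
  show "emeasure lborel ?X < \<infinity>" by (intro emeasure_bounded_finite) simp
qed simp

lemma inner_hull:
  fixes b c :: real
  obtains X where "dyadic_inv r X" "X \<in> sets borel" "emeasure lborel X < \<infinity>"
    "X \<subseteq> {b..c}" "{b + 1 / 2 ^ r .. c - 1 / 2 ^ r} \<subseteq> X"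
proof
  let ?X = "{of_int (\<lfloor>2 ^ r * b\<rfloor> + 1) / 2 ^ r ..< of_int \<lfloor>2 ^ r * c\<rfloor> / 2 ^ r :: real}"
  show "dyadic_inv r ?X" by (rule dyadic_inv_interval)
  have b: "of_int \<lfloor>2 ^ r * b\<rfloor> \<le> 2 ^ r * b" "2 ^ r * b < of_int \<lfloor>2 ^ r * b\<rfloor> + 1"
    by linarith+
  have c: "of_int \<lfloor>2 ^ r * c\<rfloor> \<le> 2 ^ r * c" "2 ^ r * c - 1 < of_int \<lfloor>2 ^ r * c\<rfloor>"
    by linarith+
  have "b \<le> of_int (\<lfloor>2 ^ r * b\<rfloor> + 1) / 2 ^ r" "of_int \<lfloor>2 ^ r * c\<rfloor> / 2 ^ r \<le> c"
    using b c by (simp_all add: field_simps)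
  then show "?X \<subseteq> {b..c}" by auto
  have "of_int (\<lfloor>2 ^ r * b\<rfloor> + 1) / 2 ^ r \<le> (2 ^ r * b + 1) / 2 ^ r"
      "(2 ^ r * c - 1) / 2 ^ r < of_int \<lfloor>2 ^ r * c\<rfloor> / 2 ^ r"
    using b c by (intro divide_right_mono divide_strict_right_mono; simp)+
  then show "{b + 1 / 2 ^ r .. c - 1 / 2 ^ r} \<subseteq> ?X"
    by (auto simp: add_divide_distrib diff_divide_distrib)
  show "emeasure lborel ?X < \<infinity>" by (intro emeasure_bounded_finite) simp
qed simp

lemma measure_le_margins:
  fixes A B :: "real set"
  assumes sub: "A \<subseteq> B \<union> {x..x + e} \<union> {y..y + e}" and "0 \<le> e"
    and A: "A \<in> sets borel" and B: "B \<in> sets borel" "emeasure lborel B < \<infinity>"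
  shows "measure lborel A \<le> measure lborel B + 2 * e"
proof -
  have fin: "emeasure lborel {x..x + e} < \<infinity>" "emeasure lborel {y..y + e} < \<infinity>"
    using \<open>0 \<le> e\<close> by simp_all
  have "measure lborel A \<le> measure lborel (B \<union> {x..x + e} \<union> {y..y + e})"
    using A B fin sub by (intro measure_mono_fmeasurable fmeasurable.Un fmeasurableI) auto
  also have "\<dots> \<le> measure lborel (B \<union> {x..x + e}) + measure lborel {y..y + e}"
    using B by (intro measure_Un_le) auto
  also have "measure lborel (B \<union> {x..x + e}) \<le> measure lborel B + measure lborel {x..x + e}"
    using B by (intro measure_Un_le) auto
  finally show ?thesis using \<open>0 \<le> e\<close> by simp
qed

definition cell :: "nat \<Rightarrow> real" where "cell k = 1 / 2 ^ digit_pos k"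

lemma cell_pos: "0 < cell k" by (simp add: cell_def)

lemma cell_Suc: "cell (Suc k) = cell k / (4 * 4 ^ k)"
  by (simp add: cell_def digit_pos_Suc power_add power_mult power2_eq_square)

lemma half_cell: "1 / 2 ^ (digit_pos (Suc k) - 1) = 2 * cell (Suc k)"
proof -
  have "digit_pos (Suc k) = Suc (digit_pos (Suc k) - 1)" by (simp add: digit_pos_Suc)
  then have "cell (Suc k) = 1 / 2 ^ Suc (digit_pos (Suc k) - 1)" unfolding cell_def by metis
  then show ?thesis by simp
qed

text \<open>The radius is the largest side of a cube that is handled at step \<open>Suc j\<close>, so that such a cube lies in the
  fence as soon as it contains an end point of the intervals of length \<open>cell j\<close>.\<close>

definition fence :: "nat \<Rightarrow> real set" where
  "fence j = (\<Union>z\<in>{0..2 ^ digit_pos j :: int}. {z * cell j - 16 * cell (Suc j) .. z * cell j + 16 * cell (Suc j)})"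

lemma fence_borel [measurable]: "fence j \<in> sets borel"
  unfolding fence_def by auto

text \<open>For \<open>\<mu> X = measure lborel (Q \<inter> X)\<close> this is the mass of \<open>Q\<close> under the dominating measure, truncated at
  depth \<open>K\<close>. Abstracting from \<open>\<mu>\<close> allows the same expression for intervals and, by pulling
  back along a coordinate, for cubes. A finite family of cubes only needs one sufficiently large \<open>K\<close>,
  so the singular limit measure is never formed.\<close>

definition weight :: "(real set \<Rightarrow> real) \<Rightarrow> nat \<Rightarrow> real" where
  "weight \<mu> K = 2 ^ K * \<mu> (level K) + (\<Sum>j\<le>K. 2 ^ j * \<mu> (fence j))"

lemma weight_ge_level:
  assumes "\<And>X. 0 \<le> \<mu> X"
  shows "2 ^ K * \<mu> (level K) \<le> weight \<mu> K"
  unfolding weight_def using assms by (simp add: sum_nonneg)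

lemma weight_ge_fence:
  assumes "\<And>X. 0 \<le> \<mu> X" and "j \<le> K"
  shows "2 ^ j * \<mu> (fence j) \<le> weight \<mu> K"
proof -
  have "2 ^ j * \<mu> (fence j) \<le> (\<Sum>j\<le>K. 2 ^ j * \<mu> (fence j))"
    using assms by (intro member_le_sum) auto
  then show ?thesis unfolding weight_def using assms(1)[of "level K"]
    by (meson add_increasing mult_nonneg_nonneg zero_le_numeral zero_le_power)
qed

lemma measure_fence: "measure lborel (fence j) \<le> 16 / 4 ^ j"
proof -
  let ?I = "\<lambda>z :: int. {z * cell j - 16 * cell (Suc j) .. z * cell j + 16 * cell (Suc j)}"
  have "measure lborel (fence j) \<le> (\<Sum>z\<in>{0..2 ^ digit_pos j :: int}. measure lborel (?I z))"
    unfolding fence_def by (intro measure_UNION_le) auto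
  also have "\<dots> = (2 ^ digit_pos j + 1) * (32 * cell (Suc j))"
    using cell_pos[of "Suc j"] by (simp add: nat_add_distrib nat_power_eq)
  also have "\<dots> \<le> (2 * 2 ^ digit_pos j) * (32 * cell (Suc j))"
    using cell_pos[of "Suc j"] by (intro mult_right_mono) auto
  also have "\<dots> = 16 / 4 ^ j"
    unfolding cell_Suc by (simp add: cell_def)
  finally show ?thesis .
qed

text \<open>The deep level contributes at most \<open>2\<close> and the fences at most \<open>16 + 8 + 4 + ... = 32\<close>.\<close>

lemma weight_unit: "weight (\<lambda>X. measure lborel ({0..1} \<inter> X)) K \<le> 34"
proof -
  let ?X = "{0..<2} :: real set"
  have "dyadic_inv 0 ?X" using dyadic_inv_interval[of 0 0 2] by simp
  then have "dyadic_inv (digit_pos (Suc 0) - 1) ?X" by (rule dyadic_inv_mono) simp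
  then have "measure lborel (?X \<inter> level K) = 2 / 2 ^ K"
    using measure_Int_level[of 0 ?X K] by simp
  moreover have "measure lborel ({0..1} \<inter> level K) \<le> measure lborel (?X \<inter> level K)"
    using emeasure_Int_finite[of ?X "level K"]
    by (intro measure_mono_fmeasurable fmeasurableI) (auto simp: less_top)
  ultimately have "2 ^ K * measure lborel ({0..1} \<inter> level K) \<le> 2 ^ K * (2 / 2 ^ K)"
    by (intro mult_left_mono) auto
  then have 1: "2 ^ K * measure lborel ({0..1} \<inter> level K) \<le> 2" by simp
  have "2 ^ j * measure lborel ({0..1} \<inter> fence j) \<le> 16 * (1 / 2) ^ j" for j
  proof -
    have "fence j \<in> fmeasurable lborel"
      unfolding fence_def by (intro fmeasurable.finite_UN fmeasurableI emeasure_bounded_finite) auto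
    then have "measure lborel ({0..1} \<inter> fence j) \<le> measure lborel (fence j)"
      by (intro measure_mono_fmeasurable) auto
    also have "\<dots> \<le> 16 / 4 ^ j" by (rule measure_fence)
    finally have "2 ^ j * measure lborel ({0..1} \<inter> fence j) \<le> 2 ^ j * (16 / 4 ^ j)"
      by (intro mult_left_mono) auto
    also have "\<dots> = 16 * (1 / 2) ^ j"
      using power_mult_distrib[of 2 "2 :: real" j] by (simp add: power_divide)
    finally show ?thesis .
  qed
  then have "(\<Sum>j\<le>K. 2 ^ j * measure lborel ({0..1} \<inter> fence j)) \<le> (\<Sum>j\<le>K. 16 * (1 / 2) ^ j)"
    by (intro sum_mono) auto
  also have "\<dots> = 16 * (\<Sum>j\<le>K. (1 / 2) ^ j)" by (simp add: sum_distrib_left)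
  also have "\<dots> \<le> 32" by (simp add: sum_gp0)
  finally show ?thesis unfolding weight_def using 1 by linarith
qed

text \<open>The digits change only at multiples of \<open>cell j\<close>.\<close>

lemma no_crossing:
  fixes J :: "real set"
  assumes "J \<subseteq> {0..1}" "\<not> (\<exists>z\<in>{0..2 ^ digit_pos j :: int}. z * cell j \<in> J)" "J = {b..c}" "s \<in> J" "t \<in> J"
  shows "\<lfloor>2 ^ digit_pos j * s\<rfloor> = \<lfloor>2 ^ digit_pos j * t\<rfloor>"
proof (rule ccontr)
  let ?N = "2 ^ digit_pos j :: real"
  have cross: "\<exists>z\<in>{0..2 ^ digit_pos j :: int}. z * cell j \<in> J"
    if "s \<in> J" "t \<in> J" "\<lfloor>?N * s\<rfloor> < \<lfloor>?N * t\<rfloor>" for s t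
  proof (intro bexI)
    let ?z = "\<lfloor>?N * t\<rfloor>"
    have z: "of_int ?z \<le> ?N * t" "?N * s < of_int ?z" using that(3) by linarith+
    have "s \<le> ?z * cell j" "?z * cell j \<le> t"
      using z by (simp_all add: cell_def field_simps)
    then show "?z * cell j \<in> J" using that(1,2) assms(3) by auto
    have "0 \<le> t" "t \<le> 1" using that assms(1) by auto
    then have "0 \<le> ?N * t" "?N * t \<le> ?N" by (simp_all add: mult_left_le)
    then have "0 \<le> ?z" "real_of_int ?z \<le> ?N" using z(1) by linarith+
    then have "0 \<le> ?z" "real_of_int ?z \<le> real_of_int (2 ^ digit_pos j)"
      by (simp_all only: of_int_power of_int_numeral)
    then show "?z \<in> {0..2 ^ digit_pos j}"
      unfolding of_int_le_iff by simp
  qed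
  assume "\<lfloor>?N * s\<rfloor> \<noteq> \<lfloor>?N * t\<rfloor>"
  then consider "\<lfloor>?N * s\<rfloor> < \<lfloor>?N * t\<rfloor>" | "\<lfloor>?N * t\<rfloor> < \<lfloor>?N * s\<rfloor>" by linarith
  then show False
    using cross[OF assms(4,5)] cross[OF assms(5,4)] assms(2) by cases blast+
qed

section \<open>The oscillation over an interval\<close>

context staircase
begin

definition C1 :: real where "C1 = C0 + 1"

definition C2 :: real where "C2 = 2 * (12 * C1) powr p"

lemma C1_ge_1: "1 \<le> C1"
  using C0_pos by (simp add: C1_def)

text \<open>Enlarging \<open>{b..c}\<close> to a union of dyadic intervals of length \<open>2 * cell (Suc k)\<close> makes the mass of
  \<open>\<phi>\<close> over \<open>level k\<close> computable, at the price of the two margins. The term \<open>M\<close> allows for points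
  outside \<open>level k\<close>.\<close>

lemma integral_le_hull:
  assumes [measurable]: "f \<in> borel_measurable borel" and "b \<le> c" "0 \<le> M"
    and f: "\<And>t. t \<in> {b..c} \<Longrightarrow> \<bar>f t\<bar> \<le> (\<phi> t + H k) * indicator (level k) t + M"
  shows "(LINT t:{b..c}|lborel. \<bar>f t\<bar>)
    \<le> C1 * H k * (measure lborel ({b..c} \<inter> level k) + 4 * cell (Suc k)) + M * (c - b)"
proof -
  define r where "r = digit_pos (Suc k) - 1"
  obtain X0 where X0: "dyadic_inv r X0" "X0 \<in> sets borel" "emeasure lborel X0 < \<infinity>"
    "{b..c} \<subseteq> X0" "X0 \<subseteq> {b - 1 / 2 ^ r .. c + 1 / 2 ^ r}" by (rule outer_hull)
  define X where "X = X0 \<inter> level k"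
  have r: "1 / 2 ^ r = 2 * cell (Suc k)" unfolding r_def by (rule half_cell)
  have X: "dyadic_inv r X" "X \<in> sets borel" "emeasure lborel X < \<infinity>" "X \<subseteq> level k"
    unfolding X_def using X0 dyadic_inv_mono[OF dyadic_inv_level, of k r] digit_pos_less[of k]
      emeasure_Int_finite[of X0 "level k"]
    by (auto simp: r_def less_top intro!: dyadic_inv_Int)
  have mX: "measure lborel X \<le> measure lborel ({b..c} \<inter> level k) + 2 * (2 * cell (Suc k))"
  proof (rule measure_le_margins[of _ _ "b - 2 * cell (Suc k)" _ c])
    show "X \<subseteq> {b..c} \<inter> level k \<union> {b - 2 * cell (Suc k)..b - 2 * cell (Suc k) + 2 * cell (Suc k)}
        \<union> {c..c + 2 * cell (Suc k)}"
      using X0(5) unfolding X_def r by auto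
    show "emeasure lborel ({b..c} \<inter> level k) < \<infinity>"
      using emeasure_Int_finite[of "{b..c}" "level k"] \<open>b \<le> c\<close> by (simp add: less_top)
  qed (use cell_pos[of "Suc k"] X(2) in auto)
  have "(\<integral>\<^sup>+t. ennreal (indicator {b..c} t * \<bar>f t\<bar>) \<partial>lborel)
      \<le> (\<integral>\<^sup>+t. ennreal (\<phi> t) * indicator X t + (ennreal (H k) * indicator X t + ennreal M * indicator {b..c} t) \<partial>lborel)"
  proof (rule nn_integral_mono)
    fix t
    show "ennreal (indicator {b..c} t * \<bar>f t\<bar>)
      \<le> ennreal (\<phi> t) * indicator X t + (ennreal (H k) * indicator X t + ennreal M * indicator {b..c} t)"
    proof (cases "t \<in> {b..c}")
      case True
      have "ennreal \<bar>f t\<bar> \<le> ennreal ((\<phi> t + H k) * indicator (level k) t + M)"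
        using f[OF True] by (rule ennreal_leI)
      also have "\<dots> = ennreal (\<phi> t) * indicator X t + (ennreal (H k) * indicator X t + ennreal M)"
        using True X0(4) phi_nonneg[of t] H_pos[of k] \<open>0 \<le> M\<close>
        by (cases "t \<in> level k") (auto simp: X_def ennreal_plus add.assoc)
      finally show ?thesis using True by simp
    qed simp
  qed
  also have "\<dots> = (\<integral>\<^sup>+t. ennreal (\<phi> t) * indicator X t \<partial>lborel) + (ennreal (H k) * emeasure lborel X + ennreal M * emeasure lborel {b..c})"
    using X(2) by (simp add: nn_integral_add nn_integral_cmult_indicator)
  also have "\<dots> \<le> ennreal (C0 * H k * measure lborel X) + (ennreal (H k) * emeasure lborel X + ennreal M * emeasure lborel {b..c})"
    using nn_integral_phi_le[OF X(1)[unfolded r_def] X(2-4)] by (rule add_right_mono)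
  also have "emeasure lborel X = ennreal (measure lborel X)"
    using X(3) by (intro emeasure_eq_ennreal_measure) auto
  also have "ennreal (C0 * H k * measure lborel X) + (ennreal (H k) * ennreal (measure lborel X) + ennreal M * emeasure lborel {b..c})
      = ennreal (C1 * H k * measure lborel X + M * (c - b))"
  proof -
    have "0 \<le> C0 * H k * measure lborel X" "0 \<le> H k * measure lborel X" "0 \<le> M * (c - b)"
      using C0_pos H_pos[of k] \<open>b \<le> c\<close> \<open>0 \<le> M\<close> by simp_all
    then have "ennreal (C0 * H k * measure lborel X + (H k * measure lborel X + M * (c - b)))
        = ennreal (C0 * H k * measure lborel X) + (ennreal (H k * measure lborel X) + ennreal (M * (c - b)))"
      by (simp only: ennreal_plus add_nonneg_nonneg)
    then show ?thesis
      using H_pos[of k] \<open>b \<le> c\<close> \<open>0 \<le> M\<close>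
      by (simp add: ennreal_mult[symmetric] less_imp_le C1_def distrib_right add.assoc)
  qed
  finally have "enn2real (\<integral>\<^sup>+t. ennreal (indicator {b..c} t * \<bar>f t\<bar>) \<partial>lborel) \<le> C1 * H k * measure lborel X + M * (c - b)"
    using C1_ge_1 H_pos[of k] \<open>b \<le> c\<close> \<open>0 \<le> M\<close> by (intro enn2real_leI) auto
  moreover have "(LINT t:{b..c}|lborel. \<bar>f t\<bar>) = enn2real (\<integral>\<^sup>+t. ennreal (indicator {b..c} t * \<bar>f t\<bar>) \<partial>lborel)"
    unfolding set_lebesgue_integral_def real_scaleR_def by (intro integral_eq_nn_integral) auto
  moreover have "C1 * H k * measure lborel X \<le> C1 * H k * (measure lborel ({b..c} \<inter> level k) + 4 * cell (Suc k))"
    using mX C1_ge_1 H_pos[of k] by (intro mult_left_mono) auto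
  ultimately show ?thesis by linarith
qed

text \<open>Since \<open>x / l \<le> 1 < p\<close>, one may replace \<open>(x / l) powr p\<close> by \<open>x / l\<close>: this turns an oscillation that is
  concentrated on a part of length \<open>x\<close> into a bound proportional to \<open>x\<close>.\<close>

lemma powr_average_le:
  assumes A: "0 \<le> A" "A \<le> 12 * C1 * H k * x" and x: "0 \<le> x" "x \<le> l" and "0 < l"
    and w: "2 ^ k * x \<le> 2 * w"
  shows "l * (A / l) powr p \<le> C2 * (H k powr p / 2 ^ k) * w"
proof -
  have "(x / l) powr p \<le> (x / l) powr 1"
    using x \<open>0 < l\<close> p_gt_1 by (intro powr_mono') auto
  then have xl: "(x / l) powr p \<le> x / l" using x \<open>0 < l\<close> by simp
  have "A / l \<le> (12 * C1 * H k) * (x / l)"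
    using A(2) \<open>0 < l\<close> by (simp add: divide_right_mono)
  then have "(A / l) powr p \<le> ((12 * C1 * H k) * (x / l)) powr p"
    using A(1) \<open>0 < l\<close> p_gt_1 by (intro powr_mono2) auto
  also have "\<dots> = (12 * C1) powr p * H k powr p * (x / l) powr p"
    using C1_ge_1 H_pos[of k] x \<open>0 < l\<close> by (simp add: powr_mult powr_divide)
  also have "\<dots> \<le> (12 * C1) powr p * H k powr p * (x / l)"
    using xl by (intro mult_left_mono) auto
  finally have "l * (A / l) powr p \<le> l * ((12 * C1) powr p * H k powr p * (x / l))"
    using \<open>0 < l\<close> by (intro mult_left_mono) auto
  also have "\<dots> = (12 * C1) powr p * H k powr p / 2 ^ k * (2 ^ k * x)"
    using \<open>0 < l\<close> by simp
  also have "\<dots> \<le> (12 * C1) powr p * H k powr p / 2 ^ k * (2 * w)"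
    using w by (intro mult_left_mono) auto
  also have "\<dots> = C2 * (H k powr p / 2 ^ k) * w" by (simp add: C2_def)
  finally show ?thesis .
qed

text \<open>If the interval contains a multiple of \<open>cell (k - 1)\<close>, it lies in a fence, and the trivial bound
  \<open>H k\<close> for the oscillation suffices. Otherwise \<open>\<phi>\<close> is a constant \<open>c\<close> off \<open>level k\<close>, so only the part in
  \<open>level k\<close>, of length \<open>T\<close>, matters. If \<open>T\<close> is large compared to \<open>cell (Suc k)\<close>, this part carries its share
  \<open>2^k * T\<close> of the deep level. If it is small, but not empty, the interval leaves \<open>level k\<close> and thus
  contains a multiple of \<open>cell k\<close>, so that it meets the next fence in a piece of length at least
  \<open>cell (Suc k)\<close>. The factor \<open>16\<close> excludes that a small \<open>T\<close> is due to a short interval inside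
  \<open>level k\<close>.\<close>

lemma oscillation_le_weight:
  assumes b: "0 \<le> b" "b + l \<le> 1" and l: "16 * cell (Suc k) < l" "l \<le> 16 * cell k"
  shows "\<exists>c. \<forall>K\<ge>Suc k. l * ((LINT t:{b..b + l}|lborel. \<bar>\<phi> t - c\<bar>) / l) powr p
    \<le> C2 * (H k powr p / 2 ^ k) * weight (\<lambda>X. measure lborel ({b..b + l} \<inter> X)) K"
proof -
  let ?J = "{b..b + l}" and ?\<delta> = "cell (Suc k)"
  let ?w = "weight (\<lambda>X. measure lborel (?J \<inter> X))"
  define T where "T = measure lborel (?J \<inter> level k)"
  have \<delta>: "0 < ?\<delta>" by (rule cell_pos)
  have l0: "0 < l" using l \<delta> by linarith
  have fin: "?J \<inter> X \<in> fmeasurable lborel" if "X \<in> sets borel" for X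
    using that emeasure_Int_finite[of ?J X] l0 by (intro fmeasurableI) (auto simp: less_top)
  have T: "0 \<le> T" "T \<le> l"
    using measure_mono_fmeasurable[of "?J \<inter> level k" ?J lborel] fin[of UNIV] l0 by (auto simp: T_def)
  have A0: "0 \<le> (LINT t:?J|lborel. \<bar>\<phi> t - c\<bar>)" for c
    unfolding set_lebesgue_integral_def by (intro integral_nonneg_AE) auto
  have sub: "?J \<subseteq> {0..1}" using b l0 by auto
  consider (cross) j z where "k = Suc j" "z \<in> {0..2 ^ digit_pos j :: int}" "z * cell j \<in> ?J"
    | (inside) "k = 0 \<or> (\<exists>j. k = Suc j \<and> \<not> (\<exists>z\<in>{0..2 ^ digit_pos j :: int}. z * cell j \<in> ?J))"
    by (cases k) blast+
  then show ?thesis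
  proof cases
    case cross
    have "\<bar>\<phi> t - 0\<bar> \<le> (\<phi> t + H k) * indicator (level k) t + H k" if "t \<in> ?J" for t
    proof (cases "t \<in> level k")
      case True
      then show ?thesis using phi_nonneg[of t] H_pos[of k] by simp
    next
      case False
      then obtain i where "i < k" "t \<in> shell i" by (rule shell_cases)
      then show ?thesis using phi_shell[of t i] H_mono[of i k] H_pos[of i] False by simp
    qed
    then have "(LINT t:?J|lborel. \<bar>\<phi> t - 0\<bar>) \<le> C1 * H k * (T + 4 * ?\<delta>) + H k * (b + l - b)"
      unfolding T_def using l0 H_pos[of k] by (intro integral_le_hull) auto
    also have "\<dots> \<le> C1 * H k * (2 * l) + C1 * H k * l"
    proof (rule add_mono)
      show "C1 * H k * (T + 4 * ?\<delta>) \<le> C1 * H k * (2 * l)"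
        using T l C1_ge_1 H_pos[of k] by (intro mult_left_mono) auto
      show "H k * (b + l - b) \<le> C1 * H k * l"
        using mult_right_mono[OF C1_ge_1, of "H k * l"] H_pos[of k] l0 by simp
    qed
    also have "\<dots> \<le> 12 * C1 * H k * l"
      using C1_ge_1 H_pos[of k] l0 by simp
    finally have A: "(LINT t:?J|lborel. \<bar>\<phi> t - 0\<bar>) \<le> 12 * C1 * H k * l" .
    have "?J \<subseteq> fence j"
      using cross(2,3) l(2) unfolding fence_def cross(1) by (intro order_trans[OF _ UN_upper[of z]]) auto
    then have "measure lborel (?J \<inter> fence j) = l" using l0 by (simp add: Int_absorb2)
    then have w: "2 ^ k * l \<le> 2 * ?w K" if "Suc k \<le> K" for K
      using weight_ge_fence[of "\<lambda>X. measure lborel (?J \<inter> X)" j K] that cross(1) by simp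
    show ?thesis
    proof (intro exI allI impI)
      fix K assume K: "Suc k \<le> K"
      show "l * ((LINT t:?J|lborel. \<bar>\<phi> t - 0\<bar>) / l) powr p \<le> C2 * (H k powr p / 2 ^ k) * ?w K"
        by (rule powr_average_le[OF A0 A _ _ l0 w[OF K]]) (use l0 in auto)
    qed
  next
    case inside
    obtain c where c: "0 \<le> c" "c \<le> H k" "\<And>t. t \<in> ?J \<Longrightarrow> t \<notin> level k \<Longrightarrow> \<phi> t = c"
    proof (cases k)
      case 0
      then show ?thesis using H_pos[of k] by (intro that[of 0]) auto
    next
      case (Suc j)
      then have nc: "\<not> (\<exists>z\<in>{0..2 ^ digit_pos j :: int}. z * cell j \<in> ?J)" using inside by auto
      have same: "s \<in> level i \<longleftrightarrow> t \<in> level i" if "s \<in> ?J" "t \<in> ?J" "i \<le> j" for s t i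
        using dyadic_inv_mono[OF dyadic_inv_level digit_pos_mono[OF that(3)]]
          no_crossing[OF sub nc refl that(1,2)] by (rule dyadic_invD)
      have bJ: "b \<in> ?J" using l0 by simp
      show ?thesis
      proof (cases "b \<in> level j")
        case True
        have "\<phi> t = H j" if "t \<in> ?J" "t \<notin> level k" for t
        proof (rule phi_shell)
          show "t \<in> shell j" using that same[OF bJ that(1), of j] True by (simp add: shell_def Suc)
        qed
        then show ?thesis using H_pos[of j] H_mono[of j k] Suc by (intro that[of "H j"]) auto
      next
        case False
        then obtain i where i: "i < j" "b \<in> shell i" by (rule shell_cases)
        have "\<phi> t = H i" if "t \<in> ?J" for t
        proof (rule phi_shell)
          show "t \<in> shell i"
            using i same[OF bJ that, of i] same[OF bJ that, of "Suc i"] by (simp add: shell_def)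
        qed
        then show ?thesis using H_pos[of i] H_mono[of i k] Suc i by (intro that[of "H i"]) auto
      qed
    qed
    have "\<bar>\<phi> t - c\<bar> \<le> (\<phi> t + H k) * indicator (level k) t + 0" if "t \<in> ?J" for t
      using c that phi_nonneg[of t] by (cases "t \<in> level k") auto
    then have A: "(LINT t:?J|lborel. \<bar>\<phi> t - c\<bar>) \<le> C1 * H k * (T + 4 * ?\<delta>)"
      unfolding T_def using l0 integral_le_hull[of "\<lambda>t. \<phi> t - c" b "b + l" 0 k] by simp
    show ?thesis
    proof (cases "8 * ?\<delta> \<le> T")
      case True
      have A': "(LINT t:?J|lborel. \<bar>\<phi> t - c\<bar>) \<le> 12 * C1 * H k * T"
      proof -
        have "C1 * H k * (T + 4 * ?\<delta>) \<le> C1 * H k * (12 * T)"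
          using True T C1_ge_1 H_pos[of k] by (intro mult_left_mono) auto
        then show ?thesis using A by simp
      qed
      have w: "2 ^ k * T \<le> 2 * ?w K" if K: "Suc k \<le> K" for K
      proof -
        define r where "r = digit_pos (Suc k) - 1"
        have r: "1 / 2 ^ r = 2 * ?\<delta>" unfolding r_def by (rule half_cell)
        obtain X0 where X0: "dyadic_inv r X0" "X0 \<in> sets borel" "emeasure lborel X0 < \<infinity>"
          "X0 \<subseteq> ?J" "{b + 1 / 2 ^ r .. (b + l) - 1 / 2 ^ r} \<subseteq> X0" by (rule inner_hull)
        define X where "X = X0 \<inter> level k"
        have X: "dyadic_inv r X" "X \<in> sets borel" "emeasure lborel X < \<infinity>" "X \<subseteq> level k"
          unfolding X_def using X0 dyadic_inv_mono[OF dyadic_inv_level, of k r] digit_pos_less[of k]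
            emeasure_Int_finite[of X0 "level k"]
          by (auto simp: r_def less_top intro!: dyadic_inv_Int)
        have "T \<le> measure lborel X + 2 * (2 * ?\<delta>)"
          unfolding T_def
        proof (rule measure_le_margins[of _ _ b _ "b + l - 2 * ?\<delta>"])
          show "?J \<inter> level k \<subseteq> X \<union> {b..b + 2 * ?\<delta>} \<union> {b + l - 2 * ?\<delta>..b + l - 2 * ?\<delta> + 2 * ?\<delta>}"
            using X0(5) unfolding X_def r by auto
        qed (use \<delta> X in auto)
        then have "T \<le> 2 * measure lborel X" using True by linarith
        also have "measure lborel X = 2 ^ (K - k) * measure lborel (X \<inter> level K)"
          using measure_Int_level[OF X(1)[unfolded r_def] X(2-4), of K] K by simp
        also have "measure lborel (X \<inter> level K) \<le> measure lborel (?J \<inter> level K)"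
          using X0(4) X(2) fin[of "level K"] by (intro measure_mono_fmeasurable) (auto simp: X_def)
        finally have "2 ^ k * T \<le> 2 ^ k * (2 * (2 ^ (K - k) * measure lborel (?J \<inter> level K)))"
          by (intro mult_left_mono) auto
        also have "\<dots> = 2 * (2 ^ (k + (K - k)) * measure lborel (?J \<inter> level K))"
          by (simp only: power_add mult_ac)
        also have "\<dots> = 2 * (2 ^ K * measure lborel (?J \<inter> level K))"
          using K by simp
        also have "\<dots> \<le> 2 * ?w K"
          using weight_ge_level[of "\<lambda>X. measure lborel (?J \<inter> X)" K] by simp
        finally show ?thesis .
      qed
      show ?thesis
        using powr_average_le[OF A0 A' T l0 w] by auto
    next
      case small: False
      show ?thesis
      proof (cases "?J \<inter> level k = {}")
        case True
        then have "\<phi> t = c" if "t \<in> ?J" for t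
          using c(3) that by blast
        then have "(LINT t:?J|lborel. \<bar>\<phi> t - c\<bar>) = 0"
          unfolding set_lebesgue_integral_def
          by (intro integral_eq_zero_AE AE_I2) (auto simp: indicator_def)
        moreover have "0 \<le> ?w K" for K
          unfolding weight_def by (intro add_nonneg_nonneg sum_nonneg mult_nonneg_nonneg) auto
        ultimately show ?thesis
          by (intro exI[of _ c]) (auto simp: C2_def)
      next
        case False
        have A': "(LINT t:?J|lborel. \<bar>\<phi> t - c\<bar>) \<le> 12 * C1 * H k * ?\<delta>"
        proof -
          have "C1 * H k * (T + 4 * ?\<delta>) \<le> C1 * H k * (12 * ?\<delta>)"
            using small C1_ge_1 H_pos[of k] by (intro mult_left_mono) auto
          then show ?thesis using A by simp
        qed
        have "\<not> ?J \<subseteq> level k"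
        proof
          assume "?J \<subseteq> level k"
          then have "T = l" unfolding T_def using l0 by (simp add: Int_absorb2)
          then show False using small l \<delta> by linarith
        qed
        with False obtain s t where st: "s \<in> ?J" "t \<in> ?J" "s \<in> level k" "t \<notin> level k" by blast
        then have "\<lfloor>2 ^ digit_pos k * s\<rfloor> \<noteq> \<lfloor>2 ^ digit_pos k * t\<rfloor>"
          using dyadic_invD[OF dyadic_inv_level] by blast
        then obtain z where z: "z \<in> {0..2 ^ digit_pos k :: int}" "z * cell k \<in> ?J"
          using no_crossing[OF sub _ refl st(1,2)] by blast
        obtain y where y: "{y..y + ?\<delta>} \<subseteq> ?J" "z * cell k - ?\<delta> \<le> y" "y \<le> z * cell k"
        proof (cases "z * cell k + ?\<delta> \<le> b + l")
          case True
          then show ?thesis using z(2) \<delta> by (intro that[of "z * cell k"]) auto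
        next
          case False
          then show ?thesis using z(2) \<delta> l by (intro that[of "z * cell k - ?\<delta>"]) auto
        qed
        have "{y..y + ?\<delta>} \<subseteq> {z * cell k - 16 * ?\<delta>..z * cell k + 16 * ?\<delta>}"
          using y(2,3) \<delta> by auto
        then have "{y..y + ?\<delta>} \<subseteq> ?J \<inter> fence k"
          using y(1) z(1) unfolding fence_def by blast
        then have "measure lborel {y..y + ?\<delta>} \<le> measure lborel (?J \<inter> fence k)"
          using fin[of "fence k"] by (intro measure_mono_fmeasurable) auto
        then have fk: "?\<delta> \<le> measure lborel (?J \<inter> fence k)" using \<delta> by simp
        have w: "2 ^ k * ?\<delta> \<le> 2 * ?w K" if "Suc k \<le> K" for K
        proof -
          have "2 ^ k * ?\<delta> \<le> 2 ^ k * measure lborel (?J \<inter> fence k)"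
            using fk by (intro mult_left_mono) auto
          also have "\<dots> \<le> ?w K"
            using that by (intro weight_ge_fence) auto
          also have "\<dots> \<le> 2 * ?w K"
            using calculation \<delta> by (smt (verit) mult_nonneg_nonneg zero_le_power)
          finally show ?thesis .
        qed
        show ?thesis
          using powr_average_le[OF A0 A' _ _ l0 w] \<delta> l by auto
      qed
    qed
  qed
qed

end

section \<open>Functions of one coordinate on cubes\<close>

lemma cube_of_sideE:
  fixes Q :: "(real ^ 'n) set"
  assumes "cube_of_side l Q"
  obtains b where "0 < l" "Q \<in> sets borel" "box b (\<chi> i. b $ i + l) \<subseteq> Q" "Q \<subseteq> cbox b (\<chi> i. b $ i + l)"
proof -
  obtain b I where l: "0 < l" and I: "\<And>i. {b $ i <..< b $ i + l} \<subseteq> I i" "\<And>i. I i \<subseteq> {b $ i .. b $ i + l}"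
    and Q: "Q = {x. \<forall>i. x $ i \<in> I i}"
    using assms unfolding cube_of_side_def by blast
  have [measurable]: "I i \<in> sets borel" for i
  proof -
    have "I i = {b $ i <..< b $ i + l} \<union> (I i \<inter> {b $ i, b $ i + l})"
      using I[of i] by (force simp: subset_iff)
    also have "\<dots> \<in> sets borel"
      by (intro sets.Un) (auto intro: borel_closed finite_imp_closed)
    finally show ?thesis .
  qed
  have "Q = (\<Inter>i. (\<lambda>x. x $ i) -` I i \<inter> space borel)" using Q by auto
  also have "\<dots> \<in> sets borel"
    by (intro sets.countable_INT'' measurable_sets[of _ borel borel]) auto
  finally have "Q \<in> sets borel" .
  moreover have "box b (\<chi> i. b $ i + l) \<subseteq> Q" "Q \<subseteq> cbox b (\<chi> i. b $ i + l)"
    using I unfolding Q by (fastforce simp: mem_box_cart)+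
  ultimately show ?thesis using that l by blast
qed

lemma emeasure_between_boxes:
  fixes d e :: "real ^ 'n"
  assumes "S \<in> sets borel" "box d e \<subseteq> S" "S \<subseteq> cbox d e" "\<And>i. d $ i \<le> e $ i"
  shows "emeasure lborel S = ennreal (\<Prod>i\<in>UNIV. e $ i - d $ i)"
proof -
  have ne: "cbox d e \<noteq> {}" using assms(4) by (auto simp: interval_ne_empty_cart)
  have "emeasure lborel (cbox d e) = ennreal (measure lborel (cbox d e))"
    by (intro emeasure_eq_ennreal_measure) (use emeasure_lborel_cbox_finite[of d e] in auto)
  then have 1: "emeasure lborel (cbox d e) = ennreal (\<Prod>i\<in>UNIV. e $ i - d $ i)"
    by (simp add: content_cbox_cart[OF ne])
  have "emeasure lborel (box d e) = emeasure lborel (cbox d e)"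
    by (simp add: emeasure_lborel_box_eq emeasure_lborel_cbox_eq)
  then show ?thesis
    using 1 emeasure_mono[of "box d e" S lborel] emeasure_mono[of S "cbox d e" lborel] assms(1-3) by auto
qed

definition coord :: "'n \<Rightarrow> real \<Rightarrow> real \<Rightarrow> real ^ 'n \<Rightarrow> real" where
  "coord m s L x = (x $ m - s) / L"

lemma coord_borel [measurable]: "coord m s L \<in> borel_measurable borel"
  unfolding coord_def by measurable

text \<open>The image of Lebesgue measure on a cube under a coordinate is a multiple of Lebesgue measure on an interval;
  comparing the masses of half-lines is enough. All integrals over cubes below are reduced to intervals by this.\<close>

lemma distr_cube_coord:
  fixes Q :: "(real ^ 'n) set"
  assumes l: "0 < l" and Q [measurable]: "Q \<in> sets borel"
    and sub: "box b (\<chi> i. b $ i + l) \<subseteq> Q" "Q \<subseteq> cbox b (\<chi> i. b $ i + l)" and L: "0 < L"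
  shows "distr (density lborel (indicator Q)) borel (coord m s L)
    = density lborel (\<lambda>t. ennreal (l ^ CARD('n) / (l / L)) * indicator {coord m s L b .. coord m s L b + l / L} t)"
    (is "?M1 = ?M2")
proof (rule measure_eqI_lessThan)
  let ?c = "coord m s L b"
  have M1: "emeasure ?M1 {t<..} = emeasure lborel (Q \<inter> {x. t < coord m s L x})" for t
    by (simp add: emeasure_distr emeasure_density vimage_def Int_def conj_commute
        flip: indicator_inter_arith)
  have M2: "emeasure ?M2 {t<..} = ennreal (l ^ CARD('n) / (l / L)) * emeasure lborel ({?c .. ?c + l / L} \<inter> {t<..})" for t
    by (simp add: emeasure_density mult.assoc nn_integral_cmult flip: indicator_inter_arith)
  have eq: "emeasure ?M1 {t<..} = emeasure ?M2 {t<..}" for t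
  proof (cases "?c + l / L \<le> t")
    case True
    then have bt: "b $ m + l \<le> s + L * t" using L by (simp add: coord_def field_simps)
    have "\<not> t < coord m s L x" if "x \<in> Q" for x
    proof -
      have "x $ m \<le> b $ m + l" using that sub(2) by (force simp: mem_box_cart)
      then show ?thesis using bt L by (simp add: coord_def field_simps)
    qed
    then have "Q \<inter> {x. t < coord m s L x} = {}" by blast
    moreover have "{?c .. ?c + l / L} \<inter> {t<..} = {}" using True by auto
    ultimately show ?thesis unfolding M1 M2 by simp
  next
    case False
    then have bt: "s + L * t < b $ m + l" using L by (simp add: coord_def field_simps)
    define \<tau> where "\<tau> = max (b $ m) (s + L * t)"
    let ?d = "\<chi> i. if i = m then \<tau> else b $ i" and ?e = "\<chi> i. b $ i + l"
    have tau: "t < coord m s L x \<longleftrightarrow> s + L * t < x $ m" for x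
      using L by (simp add: coord_def field_simps)
    have "emeasure lborel (Q \<inter> {x. t < coord m s L x}) = ennreal (\<Prod>i\<in>UNIV. ?e $ i - ?d $ i)"
    proof (rule emeasure_between_boxes)
      show "Q \<inter> {x. t < coord m s L x} \<in> sets borel" by measurable
      show "box ?d ?e \<subseteq> Q \<inter> {x. t < coord m s L x}"
      proof
        fix x assume x: "x \<in> box ?d ?e"
        have xi: "(if i = m then \<tau> else b $ i) < x $ i \<and> x $ i < b $ i + l" for i
          using x by (simp add: mem_box_cart)
        have "b $ i < x $ i \<and> x $ i < b $ i + l" for i
          using xi[of i] by (cases "i = m") (auto simp: \<tau>_def)
        then have "x \<in> box b ?e" by (simp add: mem_box_cart)
        moreover have "s + L * t < x $ m" using xi[of m] by (simp add: \<tau>_def)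
        ultimately show "x \<in> Q \<inter> {x. t < coord m s L x}" using sub(1) tau by blast
      qed
      show "Q \<inter> {x. t < coord m s L x} \<subseteq> cbox ?d ?e"
        using sub(2) unfolding tau by (force simp: mem_box_cart \<tau>_def)
      show "?d $ i \<le> ?e $ i" for i using bt l by (auto simp: \<tau>_def)
    qed
    also have "(\<Prod>i\<in>UNIV. ?e $ i - ?d $ i) = (b $ m + l - \<tau>) * (\<Prod>i\<in>UNIV - {m}. l)"
      by (subst prod.remove[of _ m]) (auto intro!: prod.cong)
    also have "\<dots> = (l ^ CARD('n) / l) * (b $ m + l - \<tau>)"
      using l by (simp add: power_diff_conv_inverse inverse_eq_divide)
    finally have 1: "emeasure ?M1 {t<..} = ennreal ((l ^ CARD('n) / l) * (b $ m + l - \<tau>))"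
      unfolding M1 .
    have "emeasure lborel ({?c .. ?c + l / L} \<inter> {t<..}) = ennreal (?c + l / L - max ?c t)"
    proof (cases "t < ?c")
      case True
      then have "{?c .. ?c + l / L} \<inter> {t<..} = {?c .. ?c + l / L}" by auto
      then show ?thesis using True l L by (simp add: max_def)
    next
      case f: False
      then have "{?c .. ?c + l / L} \<inter> {t<..} = {t <.. ?c + l / L}" by auto
      then show ?thesis using f False by (simp add: max_def)
    qed
    moreover have "?c + l / L - max ?c t = (b $ m + l - \<tau>) / L"
      using L by (auto simp: coord_def \<tau>_def max_def field_simps)
    ultimately have "emeasure ?M2 {t<..} = ennreal (l ^ CARD('n) / (l / L)) * ennreal ((b $ m + l - \<tau>) / L)"
      unfolding M2 by simp
    also have "\<dots> = ennreal (l ^ CARD('n) / (l / L) * ((b $ m + l - \<tau>) / L))"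
      using l L bt by (intro ennreal_mult[symmetric]) (auto simp: \<tau>_def)
    also have "l ^ CARD('n) / (l / L) * ((b $ m + l - \<tau>) / L) = (l ^ CARD('n) / l) * (b $ m + l - \<tau>)"
      using L by simp
    finally show ?thesis using 1 by simp
  qed
  show "emeasure ?M1 {t<..} = emeasure ?M2 {t<..}" for t by (rule eq)
  show "emeasure ?M1 {t<..} < \<infinity>" for t
  proof -
    have "emeasure lborel ({?c .. ?c + l / L} \<inter> {t<..}) < \<infinity>"
      by (intro emeasure_bounded_finite) auto
    then show ?thesis unfolding eq M2 by (simp add: ennreal_mult_less_top)
  qed
qed auto

lemma measure_cube_coord:
  fixes Q :: "(real ^ 'n) set"
  assumes "0 < l" "Q \<in> sets borel" "box b (\<chi> i. b $ i + l) \<subseteq> Q" "Q \<subseteq> cbox b (\<chi> i. b $ i + l)" "0 < L"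
    and [measurable]: "X \<in> sets borel"
  shows "measure lborel (Q \<inter> coord m s L -` X)
    = l ^ CARD('n) / (l / L) * measure lborel ({coord m s L b .. coord m s L b + l / L} \<inter> X)"
proof -
  note [measurable] = assms(2)
  have [measurable]: "coord m s L -` X \<in> sets borel"
    using measurable_sets[OF coord_borel assms(6), of m s L] by simp
  have "emeasure lborel (Q \<inter> coord m s L -` X) = emeasure (distr (density lborel (indicator Q)) borel (coord m s L)) X"
    by (simp add: emeasure_distr emeasure_density flip: indicator_inter_arith)
  also have "\<dots> = ennreal (l ^ CARD('n) / (l / L)) * emeasure lborel ({coord m s L b .. coord m s L b + l / L} \<inter> X)"
    unfolding distr_cube_coord[OF assms(1-5)]
    by (simp add: emeasure_density mult.assoc nn_integral_cmult flip: indicator_inter_arith)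
  finally show ?thesis
    using assms(1,5) by (simp add: measure_def enn2real_mult)
qed

lemma
  fixes Q :: "(real ^ 'n) set"
  assumes "0 < l" "Q \<in> sets borel" "box b (\<chi> i. b $ i + l) \<subseteq> Q" "Q \<subseteq> cbox b (\<chi> i. b $ i + l)" "0 < L"
    and [measurable]: "\<psi> \<in> borel_measurable borel"
  shows integral_cube_coord: "(LINT x:Q|lebesgue. \<psi> (coord m s L x))
      = l ^ CARD('n) / (l / L) * (LINT t:{coord m s L b .. coord m s L b + l / L}|lborel. \<psi> t)" (is ?eq)
    and integrable_cube_coord: "set_integrable lebesgue Q (\<lambda>x. \<psi> (coord m s L x)) \<longleftrightarrow>
      set_integrable lborel {coord m s L b .. coord m s L b + l / L} \<psi>" (is ?int)
proof -
  note [measurable] = assms(2)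
  let ?J = "{coord m s L b .. coord m s L b + l / L}"
  let ?M = "distr (density lborel (indicator Q)) borel (coord m s L)"
  define C where "C = l ^ CARD('n) / (l / L)"
  have c: "0 < C" using assms(1,5) by (simp add: C_def)
  have dens: "density lborel (indicator Q) = density lborel (\<lambda>x. ennreal (indicator Q x))"
    by (simp add: ennreal_indicator)
  have M: "?M = density lborel (\<lambda>t. ennreal (C * indicator ?J t))"
    unfolding distr_cube_coord[OF assms(1-5)] C_def[symmetric] using c by (simp add: ennreal_mult' ennreal_indicator)
  have "(LINT x:Q|lebesgue. \<psi> (coord m s L x)) = integral\<^sup>L ?M \<psi>"
    unfolding set_lebesgue_integral_def
    by (subst integral_distr) (simp_all add: dens integral_density integral_completion)
  also have "\<dots> = C * (LINT t:?J|lborel. \<psi> t)"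
    unfolding M set_lebesgue_integral_def using c by (subst integral_density) (simp_all add: mult.assoc)
  finally show ?eq unfolding C_def .
  have "set_integrable lebesgue Q (\<lambda>x. \<psi> (coord m s L x)) \<longleftrightarrow> integrable ?M \<psi>"
    unfolding set_integrable_def
    by (subst integrable_distr_eq) (simp_all add: dens integrable_density integrable_completion)
  also have "\<dots> \<longleftrightarrow> set_integrable lborel ?J \<psi>"
    unfolding M set_integrable_def using c by (subst integrable_density) (simp_all add: mult.assoc)
  finally show ?int .
qed

lemma mean_oscillation_le:
  fixes h :: "real ^ 'n \<Rightarrow> real"
  assumes h: "set_integrable lebesgue Q h" and Q: "Q \<in> lmeasurable" and pos: "0 < measure lebesgue Q"
  shows "mean_oscillation Q h \<le> 2 * average Q (\<lambda>x. \<bar>h x - c\<bar>)"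
proof -
  let ?v = "measure lebesgue Q" and ?A = "average Q h"
  have const: "set_integrable lebesgue Q (\<lambda>x. a :: real)" for a
    using Q unfolding set_integrable_def real_scaleR_def by (intro integrable_mult_left) (auto simp: fmeasurable_def)
  have lint_const: "(LINT x:Q|lebesgue. a) = a * ?v" for a :: real
    using set_integral_const[of Q lebesgue a] fmeasurableD[OF Q] fmeasurableD2[OF Q]
    unfolding infinity_ennreal_def by (metis mult.commute real_scaleR_def)
  have d: "set_integrable lebesgue Q (\<lambda>x. h x - a)" "set_integrable lebesgue Q (\<lambda>x. \<bar>h x - a\<bar>)" for a
    using h const by (auto intro!: set_integral_diff set_integrable_abs)
  have "?v * (?A - c) = (LINT x:Q|lebesgue. h x - c)"
    using h const pos by (simp add: set_integral_diff lint_const average_def algebra_simps)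
  then have "?v * \<bar>?A - c\<bar> = \<bar>LINT x:Q|lebesgue. h x - c\<bar>"
    using pos by (metis abs_mult abs_of_pos)
  also have "\<dots> \<le> (LINT x:Q|lebesgue. \<bar>h x - c\<bar>)"
    using set_integral_norm_bound[OF d(1)[of c]] by simp
  finally have 1: "\<bar>?A - c\<bar> * ?v \<le> (LINT x:Q|lebesgue. \<bar>h x - c\<bar>)" by (simp add: mult.commute)
  have "(LINT x:Q|lebesgue. \<bar>h x - ?A\<bar>) \<le> (LINT x:Q|lebesgue. \<bar>h x - c\<bar> + \<bar>?A - c\<bar>)"
    using d const by (intro set_integral_mono set_integral_add) auto
  also have "\<dots> = (LINT x:Q|lebesgue. \<bar>h x - c\<bar>) + \<bar>?A - c\<bar> * ?v"
    using d const by (simp add: set_integral_add lint_const)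
  also have "\<dots> \<le> 2 * (LINT x:Q|lebesgue. \<bar>h x - c\<bar>)" using 1 by simp
  finally show ?thesis
    unfolding mean_oscillation_def average_def using pos by (simp add: divide_right_mono)
qed

section \<open>Upper bounds\<close>

context staircase
begin

definition W :: "nat \<Rightarrow> real" where "W k = H k powr p / 2 ^ k"

lemma W_nonneg: "0 \<le> W k"
  by (simp add: W_def)

lemma W_antimono: "i \<le> k \<Longrightarrow> W k \<le> W i"
proof (rule lift_Suc_antimono_le[of W])
  fix k
  have "H (Suc k) powr p \<le> (2 powr (1 / p) * H k) powr p"
    using H_growth[of k] H_pos[of "Suc k"] p_gt_1 by (intro powr_mono2) auto
  also have "\<dots> = 2 * H k powr p"
    using p_gt_1 H_pos[of k] by (simp add: powr_mult powr_powr)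
  finally show "W (Suc k) \<le> W k"
    by (simp add: W_def field_simps)
qed

lemma phi_integrable: "set_integrable lborel {0..1} \<phi>"
proof -
  let ?X = "{0..<2} :: real set"
  have "dyadic_inv 0 ?X" using dyadic_inv_interval[of 0 0 2] by simp
  then have inv: "dyadic_inv (digit_pos (Suc 0) - 1) ?X" by (rule dyadic_inv_mono) simp
  have "(\<integral>\<^sup>+t. ennreal (indicator {0..1} t * \<phi> t) \<partial>lborel) \<le> (\<integral>\<^sup>+t. ennreal (\<phi> t) * indicator ?X t \<partial>lborel)"
    by (intro nn_integral_mono) (auto simp: indicator_def)
  also have "\<dots> \<le> ennreal (C0 * H 0 * measure lborel ?X)"
    using inv by (intro nn_integral_phi_le) auto
  also have "\<dots> < \<infinity>" by simp
  finally show ?thesis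
    unfolding set_integrable_def real_scaleR_def using phi_nonneg by (intro integrableI_nonneg) auto
qed

end

lemma cell_le: "cell k \<le> (1 / 2) ^ k"
proof -
  have "(2 :: real) ^ k \<le> 2 ^ digit_pos k" by (intro power_increasing) (auto simp: digit_pos_def)
  then show ?thesis by (simp add: cell_def power_one_over field_simps)
qed

lemma ex_cell_less:
  assumes "0 < (e :: real)"
  shows "\<exists>k. cell k < e"
proof -
  obtain k where "(1 / 2 :: real) ^ k < e" using real_arch_pow_inv[of e "1 / 2"] assms by auto
  then show ?thesis using cell_le[of k] by (intro exI[of _ k]) linarith
qed

lemma cell_antimono: "i \<le> k \<Longrightarrow> cell k \<le> cell i"
  unfolding cell_def using digit_pos_mono[of i k] by (simp add: frac_le)

lemma ex_scale:
  assumes "0 < l" "l \<le> 16 * cell k0"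
  obtains k where "k0 \<le> k" "16 * cell (Suc k) < l" "l \<le> 16 * cell k"
proof -
  obtain j where "cell j < l / 16" using ex_cell_less[of "l / 16"] assms by auto
  then have ex: "\<exists>k. 16 * cell (Suc k) < l"
    using cell_antimono[of j "Suc j"] by (intro exI[of _ j]) simp
  define k where "k = (LEAST k. 16 * cell (Suc k) < l)"
  have k: "16 * cell (Suc k) < l" unfolding k_def using ex by (rule LeastI_ex)
  have le: "l \<le> 16 * cell k"
  proof (cases k)
    case 0
    then show ?thesis using assms(2) cell_antimono[of 0 k0] by simp
  next
    case (Suc j)
    then show ?thesis using not_less_Least[of j "\<lambda>k. 16 * cell (Suc k) < l"] k_def by auto
  qed
  have "k0 \<le> k"
  proof (rule ccontr)
    assume "\<not> k0 \<le> k"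
    then show False using cell_antimono[of "Suc k" k0] k assms(2) by simp
  qed
  then show ?thesis using k le that by blast
qed

text \<open>The cube enters only through its corner, side and measurability, because the faces that it may or may not contain
  are null sets.\<close>

locale staircase_on_cube = staircase +
  fixes Q0 :: "(real ^ 'n) set" and a :: "real ^ 'n" and L :: real and m :: 'n
  assumes L_pos: "0 < L" and Q0_borel [measurable]: "Q0 \<in> sets borel"
    and Q0_sub: "box a (\<chi> i. a $ i + L) \<subseteq> Q0" "Q0 \<subseteq> cbox a (\<chi> i. a $ i + L)"
begin

definition u :: "real ^ 'n \<Rightarrow> real" where "u = coord m (a $ m) L"

definition f :: "real ^ 'n \<Rightarrow> real" where "f x = \<phi> (u x)"

lemma u_a [simp]: "coord m (a $ m) L a = 0" by (simp add: coord_def)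

lemma u_borel [measurable]: "u \<in> borel_measurable borel"
  unfolding u_def by measurable

lemma vimage_u_borel [measurable]: "X \<in> sets borel \<Longrightarrow> u -` X \<in> sets borel"
  using measurable_sets[OF u_borel, of X] by simp

lemma f_integrable: "set_integrable lebesgue Q0 f"
  unfolding f_def u_def
  by (subst integrable_cube_coord[OF L_pos Q0_borel Q0_sub L_pos phi_borel])
    (use phi_integrable L_pos in simp)

definition wt :: "(real ^ 'n) set \<Rightarrow> nat \<Rightarrow> real" where
  "wt Q = weight (\<lambda>X. measure lborel (Q \<inter> u -` X))"

lemma subcubeE:
  assumes "cube_of_side l Q" "Q \<subseteq> Q0"
  obtains b where "0 < l" "Q \<in> sets borel" "box b (\<chi> i. b $ i + l) \<subseteq> Q" "Q \<subseteq> cbox b (\<chi> i. b $ i + l)"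
    "0 \<le> coord m (a $ m) L b" "coord m (a $ m) L b + l / L \<le> 1" "measure lebesgue Q = l ^ CARD('n)"
proof -
  obtain b where b: "0 < l" "Q \<in> sets borel" "box b (\<chi> i. b $ i + l) \<subseteq> Q" "Q \<subseteq> cbox b (\<chi> i. b $ i + l)"
    using assms(1) by (rule cube_of_sideE)
  have ne: "box b (\<chi> i. b $ i + l) \<noteq> {}" using b(1) by (simp add: interval_ne_empty_cart)
  have "box b (\<chi> i. b $ i + l) \<subseteq> cbox a (\<chi> i. a $ i + L)"
    using b assms(2) Q0_sub by blast
  then have "\<forall>i. a $ i \<le> b $ i \<and> b $ i + l \<le> a $ i + L"
    using ne b(1) by (simp add: subset_interval_cart)
  then have "a $ m \<le> b $ m" "b $ m + l \<le> a $ m + L" by auto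
  then have "0 \<le> coord m (a $ m) L b" "coord m (a $ m) L b + l / L \<le> 1"
    using L_pos by (simp_all add: coord_def field_simps)
  moreover have "measure lebesgue Q = l ^ CARD('n)"
  proof -
    have "emeasure lborel Q = ennreal (l ^ CARD('n))"
      using emeasure_between_boxes[OF b(2-4)] b(1) by simp
    then show ?thesis using b(1,2) by (simp add: measure_def)
  qed
  ultimately show ?thesis using that b by blast
qed

lemma f_integrable_sub: "cube_of_side l Q \<Longrightarrow> Q \<subseteq> Q0 \<Longrightarrow> set_integrable lebesgue Q f"
  by (rule set_integrable_subset[OF f_integrable]) (auto elim!: subcubeE)

lemma cube_bound:
  assumes Q: "cube_of_side l Q" "Q \<subseteq> Q0" and k: "16 * cell (Suc k) < l / L" "l / L \<le> 16 * cell k" and K: "Suc k \<le> K"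
  shows "measure lebesgue Q * mean_oscillation Q f powr p \<le> 2 powr p * C2 * W k * wt Q K"
proof -
  obtain b where b: "0 < l" "Q \<in> sets borel" "box b (\<chi> i. b $ i + l) \<subseteq> Q" "Q \<subseteq> cbox b (\<chi> i. b $ i + l)"
    "0 \<le> coord m (a $ m) L b" "coord m (a $ m) L b + l / L \<le> 1" "measure lebesgue Q = l ^ CARD('n)"
    using Q by (rule subcubeE)
  let ?t = "coord m (a $ m) L b" and ?r = "l / L"
  let ?J = "{?t .. ?t + ?r}" and ?c = "l ^ CARD('n) / (l / L)"
  have c0: "0 < ?c" and l0: "0 < ?r" using b(1) L_pos by simp_all
  obtain c where c: "\<And>K. Suc k \<le> K \<Longrightarrow> ?r * ((LINT t:?J|lborel. \<bar>\<phi> t - c\<bar>) / ?r) powr p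
    \<le> C2 * (H k powr p / 2 ^ k) * weight (\<lambda>X. measure lborel (?J \<inter> X)) K"
    using oscillation_le_weight[OF b(5,6) k] by blast
  have v: "0 < measure lebesgue Q" using b by simp
  have "Q \<in> lmeasurable"
    using b(2) bounded_subset[OF bounded_cbox b(4)] by (intro bounded_set_imp_lmeasurable) auto
  then have "mean_oscillation Q f \<le> 2 * average Q (\<lambda>x. \<bar>f x - c\<bar>)"
    using f_integrable_sub[OF Q] v by (intro mean_oscillation_le) auto
  also have "average Q (\<lambda>x. \<bar>f x - c\<bar>) = (LINT t:?J|lborel. \<bar>\<phi> t - c\<bar>) / ?r"
    unfolding average_def f_def u_def
    using integral_cube_coord[OF b(1-4) L_pos, of "\<lambda>t. \<bar>\<phi> t - c\<bar>" m "a $ m"] b(1,7) by simp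
  finally have "mean_oscillation Q f \<le> 2 * ((LINT t:?J|lborel. \<bar>\<phi> t - c\<bar>) / ?r)" .
  moreover have "0 \<le> mean_oscillation Q f"
    unfolding mean_oscillation_def average_def set_lebesgue_integral_def
    by (intro mult_nonneg_nonneg integral_nonneg_AE) auto
  moreover have A0: "0 \<le> (LINT t:?J|lborel. \<bar>\<phi> t - c\<bar>)"
    unfolding set_lebesgue_integral_def by (intro integral_nonneg_AE) auto
  ultimately have "mean_oscillation Q f powr p \<le> (2 * ((LINT t:?J|lborel. \<bar>\<phi> t - c\<bar>) / ?r)) powr p"
    using p_gt_1 by (intro powr_mono2) auto
  also have "\<dots> = 2 powr p * ((LINT t:?J|lborel. \<bar>\<phi> t - c\<bar>) / ?r) powr p"
    by (rule powr_mult)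
  finally have "measure lebesgue Q * mean_oscillation Q f powr p
      \<le> measure lebesgue Q * (2 powr p * ((LINT t:?J|lborel. \<bar>\<phi> t - c\<bar>) / ?r) powr p)"
    using v by (intro mult_left_mono) auto
  also have "\<dots> = (2 powr p * ?c) * (?r * ((LINT t:?J|lborel. \<bar>\<phi> t - c\<bar>) / ?r) powr p)"
    unfolding b(7) using l0 by simp
  also have "\<dots> \<le> (2 powr p * ?c) * (C2 * (H k powr p / 2 ^ k) * weight (\<lambda>X. measure lborel (?J \<inter> X)) K)"
  proof (rule mult_left_mono[OF c[OF K]])
    show "0 \<le> 2 powr p * ?c" using c0 by (intro mult_nonneg_nonneg) auto
  qed
  also have "\<dots> = 2 powr p * C2 * W k * (?c * weight (\<lambda>X. measure lborel (?J \<inter> X)) K)"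
    by (simp only: W_def mult_ac)
  also have "?c * weight (\<lambda>X. measure lborel (?J \<inter> X)) K = wt Q K"
    unfolding wt_def weight_def u_def measure_cube_coord[OF b(1-4) L_pos level_borel]
      measure_cube_coord[OF b(1-4) L_pos fence_borel]
    by (simp only: distrib_left sum_distrib_left mult_ac)
  finally show ?thesis .
qed

lemma wt_Q0: "wt Q0 K \<le> 34 * L ^ CARD('n)"
proof -
  have "wt Q0 K = L ^ CARD('n) * weight (\<lambda>X. measure lborel ({0..1} \<inter> X)) K"
    unfolding wt_def weight_def u_def measure_cube_coord[OF L_pos Q0_borel Q0_sub L_pos level_borel]
      measure_cube_coord[OF L_pos Q0_borel Q0_sub L_pos fence_borel]
    using L_pos by (simp add: distrib_left sum_distrib_left mult_ac)
  also have "\<dots> \<le> L ^ CARD('n) * 34"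
    using weight_unit L_pos by (intro mult_left_mono) auto
  finally show ?thesis by simp
qed

lemma wt_disjoint:
  assumes "finite F" "pairwise disjnt F" "\<And>Q. Q \<in> F \<Longrightarrow> is_cube Q \<and> Q \<subseteq> Q0"
  shows "(\<Sum>Q\<in>F. wt Q K) \<le> wt Q0 K"
proof -
  have *: "(\<Sum>Q\<in>F. measure lborel (Q \<inter> u -` X)) \<le> measure lborel (Q0 \<inter> u -` X)" if X: "X \<in> sets borel" for X
  proof -
    have "bounded Q0" using Q0_sub(2) bounded_cbox bounded_subset by blast
    then have fin: "S \<in> fmeasurable lborel" if "S \<in> sets borel" "S \<subseteq> Q0" for S
      using that by (intro fmeasurableI emeasure_bounded_finite) (auto intro: bounded_subset)
    have Q: "Q \<in> sets borel" "Q \<subseteq> Q0" if "Q \<in> F" for Q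
      using assms(3)[OF that] unfolding is_cube_def by (auto elim: cube_of_sideE)
    have "(\<Sum>Q\<in>F. measure lborel (Q \<inter> u -` X)) = measure lborel (\<Union>Q\<in>F. Q \<inter> u -` X)"
    proof (rule measure_finite_Union[symmetric])
      show "disjoint_family_on (\<lambda>Q. Q \<inter> u -` X) F"
        using assms(2) unfolding disjoint_family_on_def pairwise_def disjnt_def by blast
      show "emeasure lborel (Q \<inter> u -` X) \<noteq> \<infinity>" if "Q \<in> F" for Q
      proof -
        have "Q \<inter> u -` X \<in> fmeasurable lborel" using Q[OF that] X by (intro fin) auto
        then show ?thesis by (auto simp: fmeasurable_def)
      qed
    qed (use assms(1) Q X in auto)
    also have "\<dots> \<le> measure lborel (Q0 \<inter> u -` X)"
    proof (intro measure_mono_fmeasurable fin)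
      show "(\<Union>Q\<in>F. Q \<inter> u -` X) \<in> sets lborel"
        using Q X assms(1) by (intro sets.finite_UN) auto
    qed (use Q X in auto)
    finally show ?thesis .
  qed
  have "(\<Sum>Q\<in>F. wt Q K) = 2 ^ K * (\<Sum>Q\<in>F. measure lborel (Q \<inter> u -` level K))
      + (\<Sum>j\<le>K. 2 ^ j * (\<Sum>Q\<in>F. measure lborel (Q \<inter> u -` fence j)))"
    unfolding wt_def weight_def sum.distrib sum_distrib_left by (subst sum.swap) simp
  also have "\<dots> \<le> wt Q0 K"
    unfolding wt_def weight_def by (intro add_mono sum_mono mult_left_mono *) auto
  finally show ?thesis .
qed

definition C3 :: real where "C3 = 2 powr p * C2 * (34 * L ^ CARD('n))"

lemma C3_nonneg: "0 \<le> C3"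
  using L_pos by (simp add: C3_def C2_def)

text \<open>The bound on the sides makes \<open>cube_bound\<close> available with some \<open>k \<ge> k0\<close> for each cube, and \<open>W\<close> decreases.
  A common depth \<open>K\<close> exists for finite subfamilies; the masses of disjoint cubes add up to at most that of
  \<open>Q0\<close>.\<close>

lemma JN_sum_le:
  assumes C: "C \<in> disjoint_cubes Q0" and small: "\<And>Q. Q \<in> C \<Longrightarrow> \<exists>l\<le>16 * cell k0 * L. cube_of_side l Q"
  shows "JN_sum p f C \<le> ennreal (C3 * W k0)"
proof -
  let ?g = "\<lambda>Q. measure lebesgue Q * mean_oscillation Q f powr p"
  have g0: "0 \<le> ?g Q" for Q by simp
  have fin: "sum (\<lambda>Q. ennreal (?g Q)) F \<le> ennreal (C3 * W k0)" if F: "finite F" "F \<subseteq> C" for F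
  proof -
    have "\<exists>k. \<forall>K\<ge>Suc k. ?g Q \<le> 2 powr p * C2 * W k0 * wt Q K" if Q: "Q \<in> F" for Q
    proof -
      have QQ: "Q \<in> C" "Q \<subseteq> Q0" using Q F C by (auto simp: disjoint_cubes_def)
      obtain l where l: "l \<le> 16 * cell k0 * L" "cube_of_side l Q" using small[OF QQ(1)] by blast
      have "0 < l" using l(2) by (simp add: cube_of_side_def)
      then have "0 < l / L" "l / L \<le> 16 * cell k0" using l(1) L_pos by (simp_all add: field_simps)
      then obtain k where k: "k0 \<le> k" "16 * cell (Suc k) < l / L" "l / L \<le> 16 * cell k"
        by (rule ex_scale)
      have "?g Q \<le> 2 powr p * C2 * W k0 * wt Q K" if K: "Suc k \<le> K" for K
      proof -
        have "0 \<le> wt Q K"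
          unfolding wt_def weight_def by (intro add_nonneg_nonneg sum_nonneg mult_nonneg_nonneg) auto
        then have "2 powr p * C2 * W k * wt Q K \<le> 2 powr p * C2 * W k0 * wt Q K"
          using W_antimono[OF k(1)] by (intro mult_right_mono mult_left_mono) (auto simp: C2_def)
        then show ?thesis using cube_bound[OF l(2) QQ(2) k(2,3) K] by linarith
      qed
      then show ?thesis by blast
    qed
    then obtain \<kappa> where \<kappa>: "\<And>Q K. Q \<in> F \<Longrightarrow> Suc (\<kappa> Q) \<le> K \<Longrightarrow> ?g Q \<le> 2 powr p * C2 * W k0 * wt Q K"
      by metis
    define K where "K = Suc (\<Sum>Q\<in>F. \<kappa> Q)"
    have "Suc (\<kappa> Q) \<le> K" if "Q \<in> F" for Q
      using member_le_sum[of Q F \<kappa>] that F by (simp add: K_def)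
    then have "sum ?g F \<le> (\<Sum>Q\<in>F. 2 powr p * C2 * W k0 * wt Q K)"
      by (intro sum_mono \<kappa>) auto
    also have "\<dots> = 2 powr p * C2 * W k0 * (\<Sum>Q\<in>F. wt Q K)" by (simp add: sum_distrib_left)
    also have "\<dots> \<le> 2 powr p * C2 * W k0 * (34 * L ^ CARD('n))"
    proof (intro mult_left_mono order_trans[OF wt_disjoint wt_Q0])
      show "pairwise disjnt F" using C F(2) by (auto simp: disjoint_cubes_def intro: pairwise_subset)
      show "is_cube Q \<and> Q \<subseteq> Q0" if "Q \<in> F" for Q using C F(2) that by (auto simp: disjoint_cubes_def)
    qed (use F W_nonneg in \<open>auto simp: C2_def\<close>)
    also have "\<dots> = C3 * W k0" by (simp add: C3_def)
    finally have "ennreal (sum ?g F) \<le> ennreal (C3 * W k0)" by (rule ennreal_leI)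
    then show ?thesis using g0 by (simp add: sum_ennreal)
  qed
  show ?thesis
    unfolding JN_sum_def by (subst nonneg_infsum_complete, simp, intro SUP_least, rule fin) auto
qed

lemma f_in_JN: "f \<in> JN p Q0"
proof -
  have "JN_sum p f C \<le> ennreal (C3 * W 0)" if C: "C \<in> disjoint_cubes Q0" for C
  proof (rule JN_sum_le[OF C])
    fix Q assume "Q \<in> C"
    then obtain l where l: "cube_of_side l Q" "Q \<subseteq> Q0" using C by (auto simp: disjoint_cubes_def is_cube_def)
    then obtain b where "0 \<le> coord m (a $ m) L b" "coord m (a $ m) L b + l / L \<le> 1" by (elim subcubeE)
    then have "l / L \<le> 16" by linarith
    then show "\<exists>l\<le>16 * cell 0 * L. cube_of_side l Q"
      using l(1) L_pos by (intro exI[of _ l]) (simp add: cell_def field_simps)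
  qed
  moreover have "((C3 * W 0) powr (1 / p)) powr p = C3 * W 0"
    using p_gt_1 C3_nonneg W_nonneg[of 0] by (simp add: powr_powr)
  ultimately show ?thesis
    unfolding JN_def using f_integrable by (auto intro!: exI[of _ "(C3 * W 0) powr (1 / p)"])
qed

lemma f_in_VJN:
  assumes "W \<longlonglongrightarrow> 0"
  shows "f \<in> VJN p Q0"
proof -
  have "((\<lambda>r. SUP C \<in> {C \<in> disjoint_cubes Q0. \<forall>Q\<in>C. \<exists>l\<le>r. cube_of_side l Q}. JN_sum p f C) \<longlongrightarrow> 0) (at_right (0 :: real))"
  proof (rule order_tendstoI)
    fix y :: ennreal assume "0 < y"
    have "(\<lambda>k. ennreal (C3 * W k)) \<longlonglongrightarrow> ennreal (C3 * 0)"
      using assms by (intro tendsto_ennrealI tendsto_mult_left)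
    then have "\<forall>\<^sub>F k in sequentially. ennreal (C3 * W k) < y"
      using \<open>0 < y\<close> by (intro order_tendstoD) auto
    then have "\<exists>k. ennreal (C3 * W k) < y"
      by (intro eventually_happens'[of sequentially]) auto
    then obtain k where k: "ennreal (C3 * W k) < y" ..
    have "(SUP C \<in> {C \<in> disjoint_cubes Q0. \<forall>Q\<in>C. \<exists>l\<le>r. cube_of_side l Q}. JN_sum p f C) < y"
      if "r < 16 * cell k * L" for r
    proof (rule le_less_trans[OF SUP_least k])
      fix C assume "C \<in> {C \<in> disjoint_cubes Q0. \<forall>Q\<in>C. \<exists>l\<le>r. cube_of_side l Q}"
      then have C: "C \<in> disjoint_cubes Q0" "\<forall>Q\<in>C. \<exists>l\<le>r. cube_of_side l Q" by auto
      then have "\<exists>l\<le>16 * cell k * L. cube_of_side l Q" if "Q \<in> C" for Q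
        using that \<open>r < 16 * cell k * L\<close> by (meson less_imp_le order_trans)
      with C(1) show "JN_sum p f C \<le> ennreal (C3 * W k)" by (rule JN_sum_le)
    qed
    moreover have "\<forall>\<^sub>F r in at_right 0. r < 16 * cell k * L"
      using cell_pos[of k] L_pos by (intro order_tendstoD(2)[OF tendsto_ident_at]) simp
    ultimately show "\<forall>\<^sub>F r in at_right 0. (SUP C \<in> {C \<in> disjoint_cubes Q0. \<forall>Q\<in>C. \<exists>l\<le>r. cube_of_side l Q}. JN_sum p f C) < y"
      by (auto elim: eventually_mono)
  qed auto
  then show ?thesis unfolding VJN_def using f_in_JN by simp
qed

text \<open>The shells inside \<open>[0, 1)\<close> alone give the integral \<open>(\<Sum>k. W k) / 2\<close>.\<close>

lemma f_notin_Lp: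
  assumes "\<not> summable W"
  shows "f \<notin> Lp p Q0"
proof
  assume "f \<in> Lp p Q0"
  then have "set_integrable lebesgue Q0 (\<lambda>x. (\<lambda>t. \<bar>\<phi> t\<bar> powr p) (coord m (a $ m) L x))"
    by (simp add: Lp_def f_def u_def)
  then have int: "set_integrable lborel {0..1} (\<lambda>t. \<bar>\<phi> t\<bar> powr p)"
    by (subst (asm) integrable_cube_coord[OF L_pos Q0_borel Q0_sub L_pos]) (use L_pos in auto)
  let ?X = "{0..<1} :: real set"
  have "dyadic_inv 0 ?X" using dyadic_inv_interval[of 0 0 1] by simp
  then have inv: "dyadic_inv (digit_pos (Suc 0) - 1) ?X" by (rule dyadic_inv_mono) simp
  have X: "measure lborel (?X \<inter> shell k) = 1 / 2 ^ Suc k" for k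
    using measure_Int_shell[OF inv, of k] by simp
  have fin: "emeasure lborel (?X \<inter> shell k) < \<infinity>" for k
    using emeasure_Int_finite[of ?X "shell k"] by (simp add: less_top)
  have "(\<Sum>k<N. W k) \<le> 2 * (LINT t:{0..1}|lborel. \<bar>\<phi> t\<bar> powr p)" for N
  proof -
    have "(\<Sum>k<N. H k powr p * indicator (?X \<inter> shell k) t) \<le> indicator {0..1} t * \<bar>\<phi> t\<bar> powr p" for t
    proof (cases "\<exists>k<N. t \<in> ?X \<inter> shell k")
      case True
      then obtain k where k: "k < N" "t \<in> ?X" "t \<in> shell k" by blast
      have "(\<Sum>j<N. H j powr p * indicator (?X \<inter> shell j) t) = (\<Sum>j\<in>{k}. H j powr p * indicator (?X \<inter> shell j) t)"
        using k by (intro sum.mono_neutral_right) (auto simp: indicator_inter_arith indicator_shell)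
      also have "\<dots> = H k powr p" using k by simp
      finally show ?thesis using k H_pos[of k] by (simp add: phi_shell)
    next
      case False
      then have "(\<Sum>k<N. H k powr p * indicator (?X \<inter> shell k) t) = 0"
        by (intro sum.neutral) (auto simp: indicator_def)
      then show ?thesis by simp
    qed
    then have "(\<integral>t. (\<Sum>k<N. H k powr p * indicator (?X \<inter> shell k) t) \<partial>lborel) \<le> (LINT t:{0..1}|lborel. \<bar>\<phi> t\<bar> powr p)"
      unfolding set_lebesgue_integral_def real_scaleR_def using int fin
      by (intro integral_mono Bochner_Integration.integrable_sum integrable_mult_right integrable_real_indicator)
        (auto simp: set_integrable_def)
    moreover have "(\<integral>t. (\<Sum>k<N. H k powr p * indicator (?X \<inter> shell k) t) \<partial>lborel) = (\<Sum>k<N. H k powr p * (1 / 2 ^ Suc k))"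
      using fin by (subst Bochner_Integration.integral_sum) (auto simp: X)
    moreover have "2 * (\<Sum>k<N. H k powr p * (1 / 2 ^ Suc k)) = (\<Sum>k<N. W k)"
      unfolding sum_distrib_left by (simp add: W_def)
    ultimately show ?thesis by linarith
  qed
  then have "summable W" using W_nonneg by (intro summableI_nonneg_bounded)
  with assms show False ..
qed

end

section \<open>Lower bound for small cubes, and the theorem\<close>

context staircase_on_cube
begin

text \<open>Half of the cube has the value \<open>H k\<close> and a quarter has the value \<open>H (Suc k)\<close>, so that whatever the
  average is, one of them is far from it.\<close>

lemma mean_oscillation_grid_ge:
  fixes z :: int and r k :: nat
  assumes r: "r = digit_pos (Suc k) - 1" and b: "b $ m = a $ m + L * (z / 2 ^ r)"
    and z: "0 \<le> z" "z < 2 ^ r" and D: "{z / 2 ^ r ..< (real_of_int z + 1) / 2 ^ r} \<subseteq> level k"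
  shows "(H (Suc k) - H k) / 4 \<le> mean_oscillation (box b (\<chi> i. b $ i + L / 2 ^ r)) f"
proof -
  let ?l = "L / 2 ^ r" and ?D = "{z / 2 ^ r ..< (real_of_int z + 1) / 2 ^ r :: real}"
  let ?Q = "box b (\<chi> i. b $ i + ?l)"
  have l: "0 < ?l" using L_pos by simp
  have Q: "?Q \<in> sets borel" "?Q \<subseteq> cbox b (\<chi> i. b $ i + ?l)" by (auto simp: box_subset_cbox)
  have lL: "?l / L = 1 / 2 ^ r" using L_pos by simp
  have cb: "coord m (a $ m) L b = z / 2 ^ r" using L_pos b by (simp add: coord_def)
  have J: "{coord m (a $ m) L b .. coord m (a $ m) L b + ?l / L} = {z / 2 ^ r .. (real_of_int z + 1) / 2 ^ r}" (is "_ = ?J")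
    unfolding cb lL by (simp add: add_divide_distrib)
  have v: "measure lebesgue ?Q = ?l ^ CARD('n)"
  proof -
    have "emeasure lborel ?Q = ennreal (?l ^ CARD('n))"
      using emeasure_between_boxes[OF Q(1) order_refl Q(2)] l by simp
    then show ?thesis using l by (simp add: measure_def)
  qed
  define A where "A = average ?Q f"
  have "mean_oscillation ?Q f = average ?Q (\<lambda>x. \<bar>f x - A\<bar>)"
    by (simp add: mean_oscillation_def A_def)
  also have "\<dots> = 2 ^ r * (LINT t:?J|lborel. \<bar>\<phi> t - A\<bar>)"
    unfolding average_def f_def u_def v
    using integral_cube_coord[OF l Q(1) order_refl Q(2) L_pos, of "\<lambda>t. \<bar>\<phi> t - A\<bar>" m "a $ m", unfolded J] L_pos
    by simp
  finally have osc: "mean_oscillation ?Q f = 2 ^ r * (LINT t:?J|lborel. \<bar>\<phi> t - A\<bar>)" .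
  have "real_of_int (z + 1) \<le> real_of_int (2 ^ r)" using z(2) by (simp only: of_int_le_iff)
  then have J01: "?J \<subseteq> {0..1}" using z by (auto simp: field_simps) 
  have int: "set_integrable lborel ?J (\<lambda>t. \<bar>\<phi> t - A\<bar>)"
  proof (intro set_integrable_abs set_integral_diff)
    show "set_integrable lborel ?J \<phi>" by (rule set_integrable_subset[OF phi_integrable _ J01]) auto
    show "set_integrable lborel ?J (\<lambda>_. A)"
      unfolding set_integrable_def by (intro integrable_scaleR_left integrable_real_indicator emeasure_bounded_finite) auto
  qed
  have "dyadic_inv r ?D" using dyadic_inv_interval[of r z "z + 1"] by simp
  then have D_inv: "dyadic_inv (digit_pos (Suc k) - 1) ?D" by (simp only: r)
  have fin: "emeasure lborel ?D < \<infinity>" by (intro emeasure_bounded_finite) simp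
  have D_len: "measure lborel ?D = 1 / 2 ^ r"
    by (simp add: divide_right_mono add_divide_distrib)
  have m0: "measure lborel (?D \<inter> shell k) = 1 / 2 ^ r / 2"
    using measure_Int_shell[OF D_inv _ fin D order_refl] D_len by simp
  have m1: "measure lborel (?D \<inter> shell (Suc k)) = 1 / 2 ^ r / 4"
    using measure_Int_shell[OF D_inv _ fin D, of "Suc k"] D_len by simp
  have finr: "emeasure lborel (?D \<inter> shell j) < \<infinity>" for j
    using emeasure_Int_finite[OF _ fin] by (simp add: less_top)
  let ?g = "\<lambda>t. \<bar>H k - A\<bar> * indicator (?D \<inter> shell k) t + \<bar>H (Suc k) - A\<bar> * indicator (?D \<inter> shell (Suc k)) t"
  have "?g t \<le> indicator ?J t * \<bar>\<phi> t - A\<bar>" for t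
  proof -
    consider "t \<in> ?D \<inter> shell k" | "t \<in> ?D \<inter> shell (Suc k)" | "t \<notin> ?D \<inter> shell k" "t \<notin> ?D \<inter> shell (Suc k)" by blast
    then show ?thesis
    proof cases
      case 1
      then have "t \<in> ?J" "t \<notin> shell (Suc k)" "\<phi> t = H k"
        using shell_disjoint[of t k "Suc k"] by (auto simp: phi_shell)
      then show ?thesis using 1 by simp
    next
      case 2
      then have "t \<in> ?J" "t \<notin> shell k" "\<phi> t = H (Suc k)"
        using shell_disjoint[of t k "Suc k"] by (auto simp: phi_shell)
      then show ?thesis using 2 by simp
    next
      case 3
      then show ?thesis by simp
    qed
  qed
  then have "(\<integral>t. ?g t \<partial>lborel) \<le> (LINT t:?J|lborel. \<bar>\<phi> t - A\<bar>)"
    unfolding set_lebesgue_integral_def real_scaleR_def using int finr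
    by (intro integral_mono integrable_add integrable_mult_right integrable_real_indicator)
      (auto simp: set_integrable_def)
  moreover have "(\<integral>t. ?g t \<partial>lborel) = \<bar>H k - A\<bar> * (1 / 2 ^ r / 2) + \<bar>H (Suc k) - A\<bar> * (1 / 2 ^ r / 4)"
    using finr m0 m1 by (subst Bochner_Integration.integral_add) auto
  ultimately have "2 ^ r * (\<bar>H k - A\<bar> * (1 / 2 ^ r / 2) + \<bar>H (Suc k) - A\<bar> * (1 / 2 ^ r / 4)) \<le> mean_oscillation ?Q f"
    unfolding osc by (intro mult_left_mono) auto
  moreover have "2 ^ r * (\<bar>H k - A\<bar> * (1 / 2 ^ r / 2) + \<bar>H (Suc k) - A\<bar> * (1 / 2 ^ r / 4))
      = \<bar>H k - A\<bar> / 2 + \<bar>H (Suc k) - A\<bar> / 4"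
    by (simp add: distrib_left)
  ultimately have "\<bar>H k - A\<bar> / 2 + \<bar>H (Suc k) - A\<bar> / 4 \<le> mean_oscillation ?Q f" by metis
  moreover have "(H (Suc k) - H k) / 4 \<le> \<bar>H k - A\<bar> / 2 + \<bar>H (Suc k) - A\<bar> / 4"
    by (simp add: abs_if)
  ultimately show ?thesis by (rule order_trans[rotated])
qed

text \<open>Open grid cubes avoid any question about the boundary of \<open>Q0\<close>; the closed ones, which have the same volumes,
  cover the part of \<open>Q0\<close> over \<open>level k\<close>.\<close>

lemma JN_sum_grid_ge:
  obtains C where "C \<in> disjoint_cubes Q0" "\<And>Q. Q \<in> C \<Longrightarrow> cube_of_side (L * (2 * cell (Suc k))) Q"
    "ennreal (L ^ CARD('n) * (H k powr p / 2 ^ k) * ((H (Suc k) / H k - 1) / 4) powr p) \<le> JN_sum p f C"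
proof -
  define r where r: "r = digit_pos (Suc k) - 1"
  let ?l = "L / 2 ^ r"
  have l: "0 < ?l" using L_pos by simp
  have "?l = L * (1 / 2 ^ r)" by simp
  then have l_eq: "?l = L * (2 * cell (Suc k))" unfolding r half_cell .
  define b where "b z = (\<chi> i. a $ i + L * (z i / 2 ^ r))" for z :: "'n \<Rightarrow> int"
  define B where "B z = box (b z) (\<chi> i. b z $ i + ?l)" for z
  define Z where "Z = {z. z \<in> PiE UNIV (\<lambda>_. {0..<2 ^ r :: int}) \<and> {z m / 2 ^ r ..< (z m + 1) / 2 ^ r :: real} \<subseteq> level k}"
  have Z: "0 \<le> z i" "z i < 2 ^ r" "{z m / 2 ^ r ..< (z m + 1) / 2 ^ r} \<subseteq> level k" if "z \<in> Z" for z i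
    using that by (auto simp: Z_def PiE_UNIV_domain)
  have finZ: "finite Z"
    by (rule finite_subset[of _ "PiE UNIV (\<lambda>_. {0..<2 ^ r :: int})"]) (auto simp: Z_def intro!: finite_PiE)
  have floor_B: "\<lfloor>2 ^ r * ((x $ i - a $ i) / L)\<rfloor> = z i" if "x \<in> B z" for x z i
  proof -
    have "a $ i + L * (z i / 2 ^ r) < x $ i" "x $ i < a $ i + L * (z i / 2 ^ r) + L / 2 ^ r"
      using that by (simp_all add: B_def b_def mem_box_cart)
    then have "z i < 2 ^ r * ((x $ i - a $ i) / L)" "2 ^ r * ((x $ i - a $ i) / L) < z i + 1"
      using L_pos by (simp_all add: field_simps)
    then show ?thesis by linarith
  qed
  have B_ne: "B z \<noteq> {}" for z using l by (simp add: B_def interval_ne_empty_cart)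
  have inj: "inj_on B Z"
  proof
    fix z z' assume "B z = B z'"
    then obtain x where "x \<in> B z" "x \<in> B z'" using B_ne[of z] by auto
    then show "z = z'" using floor_B by (metis ext)
  qed
  have B_sub: "B z \<subseteq> Q0" if "z \<in> Z" for z
  proof -
    have le: "a $ i \<le> b z $ i \<and> b z $ i + ?l \<le> a $ i + L" for i
    proof -
      have "real_of_int (z i + 1) \<le> real_of_int (2 ^ r)" "0 \<le> real_of_int (z i)"
        using Z(1,2)[OF that, of i] by (simp_all only: of_int_le_iff of_int_0_le_iff)
      then have "L * (real_of_int (z i + 1) / 2 ^ r) \<le> L * 1" "0 \<le> L * (z i / 2 ^ r)"
        using L_pos by (intro mult_left_mono mult_nonneg_nonneg; simp)+
      then show ?thesis by (simp add: b_def add_divide_distrib distrib_left)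
    qed
    have "x \<in> box a (\<chi> i. a $ i + L)" if x: "x \<in> B z" for x
    proof -
      have "b z $ i < x $ i \<and> x $ i < b z $ i + ?l" for i
        using x by (simp add: B_def mem_box_cart)
      then have "a $ i < x $ i \<and> x $ i < a $ i + L" for i
        using le[of i] by (meson le_less_trans less_le_trans)
      then show ?thesis by (simp add: mem_box_cart)
    qed
    then show ?thesis using Q0_sub(1) by blast
  qed
  have side: "cube_of_side ?l (B z)" for z
    unfolding cube_of_side_def
  proof (intro conjI exI)
    show "0 < ?l" by (rule l)
    show "\<forall>i. {b z $ i<..<b z $ i + ?l} \<subseteq> {b z $ i<..<b z $ i + ?l} \<and> {b z $ i<..<b z $ i + ?l} \<subseteq> {b z $ i..b z $ i + ?l}"
      by auto
    show "B z = {x. \<forall>i. x $ i \<in> {b z $ i<..<b z $ i + ?l}}"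
      by (auto simp: B_def mem_box_cart)
  qed
  have "B ` Z \<in> disjoint_cubes Q0"
  proof -
    have disj: "disjnt (B z) (B z')" if "B z \<noteq> B z'" for z z'
      unfolding disjnt_def
    proof (rule ccontr)
      assume "B z \<inter> B z' \<noteq> {}"
      then obtain x where "x \<in> B z" "x \<in> B z'" by blast
      then have "z = z'" using floor_B by (metis ext)
      then show False using that by simp
    qed
    show ?thesis
      unfolding disjoint_cubes_def
    proof (intro CollectI conjI ballI)
      show "countable (B ` Z)" using finZ by (intro countable_finite finite_imageI)
      show "pairwise disjnt (B ` Z)"
        unfolding pairwise_image by (intro pairwiseI) (use disj in blast)
      show "is_cube Q" "Q \<subseteq> Q0" if "Q \<in> B ` Z" for Q
        using that B_sub side unfolding is_cube_def by blast+
    qed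
  qed
  moreover have "cube_of_side (L * (2 * cell (Suc k))) Q" if "Q \<in> B ` Z" for Q
    using that side l_eq by auto
  moreover have "ennreal (L ^ CARD('n) * (H k powr p / 2 ^ k) * ((H (Suc k) / H k - 1) / 4) powr p) \<le> JN_sum p f (B ` Z)"
  proof -
    let ?S = "box a (\<chi> i. a $ i + L)" and ?\<epsilon> = "((H (Suc k) - H k) / 4) powr p"
    let ?K = "\<lambda>z. cbox (b z) (\<chi> i. b z $ i + ?l)"
    have vK: "emeasure lborel (?K z) = ennreal (?l ^ CARD('n))" for z
      using emeasure_between_boxes[of "?K z" "b z" "\<chi> i. b z $ i + ?l"] l by (simp add: box_subset_cbox)
    have vB: "measure lebesgue (B z) = ?l ^ CARD('n)" for z
    proof -
      have "emeasure lborel (B z) = ennreal (?l ^ CARD('n))"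
        using emeasure_between_boxes[of "B z" "b z" "\<chi> i. b z $ i + ?l"] l by (simp add: B_def box_subset_cbox)
      then show ?thesis using l by (simp add: measure_def B_def)
    qed
    have S_meas: "?S \<in> sets borel" and S_sub: "?S \<subseteq> cbox a (\<chi> i. a $ i + L)" by (auto simp: box_subset_cbox)
    let ?X = "{0..<1} :: real set"
    have "dyadic_inv 0 ?X" using dyadic_inv_interval[of 0 0 1] by simp
    then have inv: "dyadic_inv (digit_pos (Suc 0) - 1) ?X" by (rule dyadic_inv_mono) simp
    have "1 / 2 ^ k = measure lborel (?X \<inter> level k)"
      using measure_Int_level[OF inv, of k] by simp
    also have "\<dots> \<le> measure lborel ({0..1} \<inter> level k)"
      using emeasure_Int_finite[of "{0..1 :: real}" "level k"]
      by (intro measure_mono_fmeasurable fmeasurableI) (auto simp: less_top)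
    finally have "L ^ CARD('n) * (1 / 2 ^ k) \<le> L ^ CARD('n) * measure lborel ({0..1} \<inter> level k)"
      using L_pos by (intro mult_left_mono) auto
    also have "\<dots> = measure lborel (?S \<inter> u -` level k)"
      unfolding u_def measure_cube_coord[OF L_pos S_meas order_refl S_sub L_pos level_borel] using L_pos by simp
    also have "\<dots> \<le> measure lborel (\<Union>z\<in>Z. ?K z)"
    proof (intro measure_mono_fmeasurable)
      show "?S \<inter> u -` level k \<subseteq> (\<Union>z\<in>Z. ?K z)"
      proof
        fix x assume x: "x \<in> ?S \<inter> u -` level k"
        define z where "z i = \<lfloor>2 ^ r * ((x $ i - a $ i) / L)\<rfloor>" for i
        have zx: "0 \<le> z i" "z i < 2 ^ r" "z i \<le> 2 ^ r * ((x $ i - a $ i) / L)" "2 ^ r * ((x $ i - a $ i) / L) \<le> z i + 1" for i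
        proof -
          have "0 < (x $ i - a $ i) / L" "(x $ i - a $ i) / L < 1"
            using x L_pos by (simp_all add: mem_box_cart field_simps)
          then have "0 \<le> 2 ^ r * ((x $ i - a $ i) / L)" "2 ^ r * ((x $ i - a $ i) / L) < 2 ^ r * 1"
            by (intro mult_nonneg_nonneg mult_strict_left_mono; simp)+
          then show "0 \<le> z i" "z i < 2 ^ r"
            unfolding z_def by (simp_all only: zero_le_floor floor_less_iff) simp
          show "z i \<le> 2 ^ r * ((x $ i - a $ i) / L)" "2 ^ r * ((x $ i - a $ i) / L) \<le> z i + 1"
            unfolding z_def by linarith+
        qed
        have "{z m / 2 ^ r ..< (z m + 1) / 2 ^ r} \<subseteq> level k"
        proof
          fix t :: real assume t: "t \<in> {z m / 2 ^ r ..< (z m + 1) / 2 ^ r}"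
          then have "z m \<le> 2 ^ r * t" "2 ^ r * t < z m + 1" by (simp_all add: field_simps)
          then have "\<lfloor>2 ^ r * t\<rfloor> = z m" by linarith
          then have "\<lfloor>2 ^ r * t\<rfloor> = \<lfloor>2 ^ r * u x\<rfloor>" by (simp add: z_def u_def coord_def)
          moreover have "dyadic_inv r (level k)"
            using dyadic_inv_level digit_pos_less unfolding r by (rule dyadic_inv_mono)
          ultimately have "t \<in> level k \<longleftrightarrow> u x \<in> level k" by (intro dyadic_invD)
          then show "t \<in> level k" using x by simp
        qed
        then have "z \<in> Z" using zx by (simp add: Z_def PiE_UNIV_domain)
        moreover have "x \<in> ?K z"
        proof -
          have "a $ i + L * (z i / 2 ^ r) \<le> x $ i \<and> x $ i \<le> a $ i + L * (z i / 2 ^ r) + L / 2 ^ r" for i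
            using zx(3,4)[of i] L_pos by (simp add: field_simps)
          then show ?thesis by (simp add: b_def mem_box_cart)
        qed
        ultimately show "x \<in> (\<Union>z\<in>Z. ?K z)" by blast
      qed
      show "?S \<inter> u -` level k \<in> sets lborel" by measurable
      show "(\<Union>z\<in>Z. ?K z) \<in> fmeasurable lborel"
        using finZ by (intro fmeasurable.finite_UN fmeasurableI) (auto simp: vK)
    qed
    also have "\<dots> \<le> (\<Sum>z\<in>Z. measure lborel (?K z))"
      using finZ by (intro measure_UNION_le) auto
    also have "\<dots> = (\<Sum>z\<in>Z. ?l ^ CARD('n))"
      using vK l by (intro sum.cong) (auto simp: measure_def)
    finally have vol: "L ^ CARD('n) * (1 / 2 ^ k) \<le> (\<Sum>z\<in>Z. ?l ^ CARD('n))" .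
    have "H k powr p * ((H (Suc k) / H k - 1) / 4) powr p = (H k * ((H (Suc k) / H k - 1) / 4)) powr p"
      by (rule powr_mult[symmetric])
    also have "H k * ((H (Suc k) / H k - 1) / 4) = (H (Suc k) - H k) / 4"
      using H_pos[of k] by (simp add: field_simps)
    finally have eps: "H k powr p * ((H (Suc k) / H k - 1) / 4) powr p = ?\<epsilon>" .
    have "L ^ CARD('n) * (H k powr p / 2 ^ k) * ((H (Suc k) / H k - 1) / 4) powr p = L ^ CARD('n) * (1 / 2 ^ k) * ?\<epsilon>"
      unfolding eps[symmetric] by simp
    also have "\<dots> \<le> (\<Sum>z\<in>Z. ?l ^ CARD('n)) * ?\<epsilon>"
      using vol by (intro mult_right_mono) auto
    also have "\<dots> = (\<Sum>z\<in>Z. measure lebesgue (B z) * ?\<epsilon>)"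
      unfolding vB by (simp only: sum_distrib_right)
    also have "\<dots> \<le> (\<Sum>z\<in>Z. measure lebesgue (B z) * mean_oscillation (B z) f powr p)"
    proof (intro sum_mono mult_left_mono powr_mono2)
      fix z assume "z \<in> Z"
      note Z = Z[OF this]
      show "(H (Suc k) - H k) / 4 \<le> mean_oscillation (B z) f"
        unfolding B_def by (rule mean_oscillation_grid_ge[OF r _ Z(1,2,3)]) (simp add: b_def)
    qed (use p_gt_1 H_Suc_mono[of k] in auto)
    finally have "ennreal (L ^ CARD('n) * (H k powr p / 2 ^ k) * ((H (Suc k) / H k - 1) / 4) powr p)
        \<le> (\<Sum>z\<in>Z. ennreal (measure lebesgue (B z) * mean_oscillation (B z) f powr p))"
      by (subst sum_ennreal) (auto intro: ennreal_leI)
    also have "\<dots> = JN_sum p f (B ` Z)"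
      unfolding JN_sum_def using finZ inj by (simp add: sum.reindex)
    finally show ?thesis .
  qed
  ultimately show ?thesis using that by blast
qed

lemma f_notin_VJN:
  assumes "0 < w" and "0 < q" and W: "\<And>k. w \<le> W k" and growth: "\<And>k. (1 + q) * H k \<le> H (Suc k)"
  shows "f \<notin> VJN p Q0"
proof
  let ?\<kappa> = "L ^ CARD('n) * w * (q / 4) powr p"
  assume "f \<in> VJN p Q0"
  then have lim: "((\<lambda>r. SUP C \<in> {C \<in> disjoint_cubes Q0. \<forall>Q\<in>C. \<exists>l\<le>r. cube_of_side l Q}. JN_sum p f C) \<longlongrightarrow> 0) (at_right (0 :: real))"
    by (simp add: VJN_def)
  have pos: "0 < ?\<kappa>" using assms(1,2) L_pos by simp
  have "\<forall>\<^sub>F r in at_right 0. (SUP C \<in> {C \<in> disjoint_cubes Q0. \<forall>Q\<in>C. \<exists>l\<le>r. cube_of_side l Q}. JN_sum p f C) < ennreal ?\<kappa>"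
    using lim by (rule order_tendstoD) (use pos in simp)
  then obtain r where r: "0 < r" "\<And>s. 0 < s \<Longrightarrow> s < r \<Longrightarrow>
      (SUP C \<in> {C \<in> disjoint_cubes Q0. \<forall>Q\<in>C. \<exists>l\<le>s. cube_of_side l Q}. JN_sum p f C) < ennreal ?\<kappa>"
    by (auto simp: eventually_at_right_field)
  obtain k where k: "cell k < r / (2 * L)" using ex_cell_less[of "r / (2 * L)"] r(1) L_pos by auto
  let ?s = "L * (2 * cell (Suc k))"
  have "cell (Suc k) < r / (2 * L)" using k cell_antimono[of k "Suc k"] by simp
  then have s: "0 < ?s" "?s < r" using cell_pos[of "Suc k"] L_pos by (simp_all add: field_simps)
  obtain C where C: "C \<in> disjoint_cubes Q0" "\<And>Q. Q \<in> C \<Longrightarrow> cube_of_side ?s Q"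
    "ennreal (L ^ CARD('n) * (H k powr p / 2 ^ k) * ((H (Suc k) / H k - 1) / 4) powr p) \<le> JN_sum p f C"
    by (rule JN_sum_grid_ge[of k]) blast
  have "q \<le> H (Suc k) / H k - 1" using growth[of k] H_pos[of k] by (simp add: field_simps)
  then have "(q / 4) powr p \<le> ((H (Suc k) / H k - 1) / 4) powr p"
    using assms(2) p_gt_1 by (intro powr_mono2) auto
  then have "?\<kappa> \<le> L ^ CARD('n) * (H k powr p / 2 ^ k) * ((H (Suc k) / H k - 1) / 4) powr p"
    using W[of k] assms(1) L_pos unfolding W_def by (intro mult_mono) auto
  then have "ennreal ?\<kappa> \<le> JN_sum p f C" using C(3) by (meson ennreal_leI order_trans)
  also have "\<dots> \<le> (SUP C \<in> {C \<in> disjoint_cubes Q0. \<forall>Q\<in>C. \<exists>l\<le>?s. cube_of_side l Q}. JN_sum p f C)"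
    using C(1,2) by (intro SUP_upper) auto
  also have "\<dots> < ennreal ?\<kappa>" by (rule r(2)[OF s])
  finally show False by simp
qed

end

theorem mainTheorem6:
  fixes p :: real and Q0 :: "(real ^ 'n) set"
  assumes "1 < p" and "is_cube Q0"
  shows "(\<exists>g. g \<in> JN p Q0 - VJN p Q0) \<and> (\<exists>g0. g0 \<in> VJN p Q0 - Lp p Q0)"
proof -
  obtain L where "cube_of_side L Q0" using assms(2) by (auto simp: is_cube_def)
  then obtain a where Q0: "0 < L" "Q0 \<in> sets borel" "box a (\<chi> i. a $ i + L) \<subseteq> Q0"
    "Q0 \<subseteq> cbox a (\<chi> i. a $ i + L)" by (rule cube_of_sideE)
  fix m :: 'n
  define G :: "nat \<Rightarrow> real" where "G k = (2 powr (1 / p)) ^ k" for k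
  define G0 :: "nat \<Rightarrow> real" where "G0 k = (2 ^ k / (k + 1)) powr (1 / p)" for k
  have q: "1 < 2 powr (1 / p)" using assms(1) by simp
  interpret G: staircase_on_cube p G Q0 a L m
  proof
    show "0 < G k" "G k \<le> G (Suc k)" "G (Suc k) \<le> 2 powr (1 / p) * G k" for k
      using q by (simp_all add: G_def)
  qed (use assms Q0 in auto)
  have WG: "G.W k = 1" for k
  proof -
    have "G k powr p = ((2 powr (1 / p)) powr k) powr p" unfolding G_def by (simp add: powr_realpow)
    also have "\<dots> = 2 ^ k" using assms(1) by (simp add: powr_powr powr_realpow)
    finally show ?thesis by (simp add: G.W_def)
  qed
  have "G.f \<notin> VJN p Q0"
    by (rule G.f_notin_VJN[of 1 "2 powr (1 / p) - 1"]) (use q in \<open>auto simp: WG G_def\<close>)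
  then have 1: "G.f \<in> JN p Q0 - VJN p Q0" using G.f_in_JN by simp
  interpret G0: staircase_on_cube p G0 Q0 a L m
  proof
    show "0 < G0 k" for k by (simp add: G0_def)
    show "G0 k \<le> G0 (Suc k)" for k
      unfolding G0_def using assms(1) by (intro powr_mono2) (auto simp: field_simps)
    have "G0 (Suc k) \<le> (2 * (2 ^ k / (k + 1))) powr (1 / p)" for k
      unfolding G0_def using assms(1) by (intro powr_mono2) (auto simp: field_simps)
    then show "G0 (Suc k) \<le> 2 powr (1 / p) * G0 k" for k
      unfolding G0_def by (simp only: powr_mult)
  qed (use assms Q0 in auto)
  have WG0: "G0.W = (\<lambda>k. 1 / real (Suc k))"
    using assms(1) by (auto simp: G0.W_def G0_def powr_powr)
  have "G0.f \<in> VJN p Q0"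
    by (rule G0.f_in_VJN) (unfold WG0, rule lim_1_over_n[THEN LIMSEQ_Suc])
  moreover have "G0.f \<notin> Lp p Q0"
  proof (rule G0.f_notin_Lp)
    show "\<not> summable G0.W"
      unfolding WG0 using not_summable_harmonic[where 'a = real] summable_Suc_iff[of "\<lambda>n. 1 / real n"]
      by (simp add: inverse_eq_divide)
  qed
  ultimately have 2: "G0.f \<in> VJN p Q0 - Lp p Q0" by simp
  show ?thesis using 1 2 by blast
qed

end
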